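(* Let $\mathfrak{a}=\mathfrak{a}_0\oplus\mathfrak{a}_1$ be a Lie antialgebra over $\mathbb{K}$, and let $\mathfrak{g}_{\mathfrak{a}}=(\mathfrak{g}_{\mathfrak{a}})_0\oplus(\mathfrak{g}_{\mathfrak{a}})_1$ be the associated $\mathbb{Z}_2$-graded vector space $(\mathfrak{g}_{\mathfrak a})_1=\mathfrak a_1$, $(\mathfrak{g}_{\mathfrak a})_0=(\mathfrak a_1\otimes\mathfrak a_1)/\mathcal S$. Then the bracket on $\mathfrak{g}_{\mathfrak{a}}$ given by $$[a,b]=a\odot b,\qquad [a\odot b,c]=-[c,a\odot b]=a(bc)+b(ac),\qquad [a\odot b,c\odot d]=2\,a(bc)\odot d+2\,b(ad)\odot c$$ for $a,b,c,d\in\mathfrak{a}_1$ (extended bilinearly) is a Lie superbracket; that is, for all homogeneous $X,Y,Z\in\mathfrak{g}_{\mathfrak{a}}$ of parities $\bar X,\bar Y,\bar Z$, $$[X,Y]=-(-1)^{\bar X\bar Y}[Y,X],$$ $$(-1)^{\bar X\bar Z}[[X,Y],Z]+(-1)^{\bar Y\bar X}[[Y,Z],X]+(-1)^{\bar Z\bar Y}[[Z,X],Y]=0.$$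
   Context: $\mathbb{K}=\mathbb{R}$ or $\mathbb{C}$. A superalgebra is a (not necessarily associative) $\mathbb{Z}_2$-graded algebra $\mathfrak{a}=\mathfrak{a}_0\oplus\mathfrak{a}_1$ with $\mathfrak a_i\cdot\mathfrak a_j\subset\mathfrak a_{i+j}$; it is supercommutative if $a\cdot b=(-1)^{\bar a\bar b}b\cdot a$ for homogeneous $a,b$, where $\bar a$ denotes parity. A Lie antialgebra is a supercommutative superalgebra $\mathfrak{a}=\mathfrak{a}_0\oplus\mathfrak{a}_1$ such that, for all $x,x_i\in\mathfrak{a}_0$ and $y,y_i\in\mathfrak{a}_1$: (LA0) $x_1(x_2x_3)=(x_1x_2)x_3$; (LA1) $x_1(x_2y)=\frac12(x_1x_2)y$; (LA2) $x(y_1y_2)=(xy_1)y_2+y_1(xy_2)$; (LA3) $y_1(y_2y_3)+y_2(y_3y_1)+y_3(y_1y_2)=0$. Construction of $\mathfrak g_{\mathfrak a}$: $(\mathfrak{g}_{\mathfrak{a}})_1:=\mathfrak{a}_1$ and $(\mathfrak{g}_{\mathfrak{a}})_0:=(\mathfrak{a}_1\otimes\mathfrak{a}_1)/\mathcal{S}$, where $\mathcal{S}$ is the linear subspace spanned by $\{a\otimes b-b\otimes a,\ ax\otimes b-a\otimes bx : a,b\in\mathfrak{a}_1,\ x\in\mathfrak{a}_0\}$; $a\odot b$ denotes the class of $a\otimes b$ in $(\mathfrak{g}_{\mathfrak{a}})_0$. Juxtaposition denotes the product of $\mathfrak{a}$. *)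

theory Defs
  imports
    Complex_Main
    "HOL-Library.Poly_Mapping"
    "HOL-Library.Z2"
    "HOL-Algebra.Algebraic_Closure_Type"
begin

text \<open>
  Vector spaces over a field type are modules, in the sense of \<^theory>\<open>HOL-Algebra.Module\<close>, over
  \<^const>\<open>ring_of_type_algebra\<close>. The fields \<^const>\<open>monoid.mult\<close> and \<^const>\<open>monoid.one\<close> that a module
  record inherits from \<^typ>\<open>'a ring\<close> are never used; products and brackets are separate parameters.
  Gradings are indexed by the type \<^typ>\<open>bit\<close> of integers mod 2.

  The ground field being the reals or the complex numbers is expressed by the type class
  \<^class>\<open>real_normed_field\<close>: both are instances, and by the theorem of Gelfand and Mazur every
  instance is isomorphic to one of them.
\<close>

abbreviation scalars :: "'k::field ring"
  where "scalars \<equiv> ring_of_type_algebra"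

definition bilinear_map ::
    "('k::field, 'a) module \<Rightarrow> ('k, 'b) module \<Rightarrow> ('k, 'c) module \<Rightarrow> ('a \<Rightarrow> 'b \<Rightarrow> 'c) \<Rightarrow> bool"
  where "bilinear_map U V W f \<longleftrightarrow>
    (\<forall>u \<in> carrier U. \<forall>v \<in> carrier V. f u v \<in> carrier W) \<and>
    (\<forall>u \<in> carrier U. \<forall>u' \<in> carrier U. \<forall>v \<in> carrier V.
      f (u \<oplus>\<^bsub>U\<^esub> u') v = f u v \<oplus>\<^bsub>W\<^esub> f u' v) \<and>
    (\<forall>u \<in> carrier U. \<forall>v \<in> carrier V. \<forall>v' \<in> carrier V.
      f u (v \<oplus>\<^bsub>V\<^esub> v') = f u v \<oplus>\<^bsub>W\<^esub> f u v') \<and>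
    (\<forall>k. \<forall>u \<in> carrier U. \<forall>v \<in> carrier V.
      f (k \<odot>\<^bsub>U\<^esub> u) v = k \<odot>\<^bsub>W\<^esub> f u v \<and> f u (k \<odot>\<^bsub>V\<^esub> v) = k \<odot>\<^bsub>W\<^esub> f u v)"

definition parity_sign :: "bit \<Rightarrow> 'k::field"
  where "parity_sign i = (if i = 0 then 1 else - 1)"

locale graded_space = module "scalars :: 'k::field ring" V
  for V :: "('k::field, 'v) module" (structure) +
  fixes part :: "bit \<Rightarrow> 'v set"
  assumes part_submodule: "submodule (part i) scalars V"
    and part_sum: "part 0 <+>\<^bsub>V\<^esub> part 1 = carrier V"
    and part_inter: "part 0 \<inter> part 1 = {\<zero>\<^bsub>V\<^esub>}"

locale superalgebra = graded_space V part
  for V :: "('k::field, 'v) module" (structure) and part +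
  fixes mul :: "'v \<Rightarrow> 'v \<Rightarrow> 'v"
  assumes mul_bilinear: "bilinear_map V V V mul"
    and mul_graded: "\<lbrakk>a \<in> part i; b \<in> part j\<rbrakk> \<Longrightarrow> mul a b \<in> part (i + j)"

locale lie_antialgebra = superalgebra V part mul
  for V :: "('k::field, 'v) module" (structure) and part and mul (infixl \<open>\<star>\<close> 75) +
  assumes supercommutative:
      "\<lbrakk>a \<in> part i; b \<in> part j\<rbrakk> \<Longrightarrow> a \<star> b = parity_sign (i * j) \<odot>\<^bsub>V\<^esub> (b \<star> a)"
    and LA0: "\<lbrakk>x\<^sub>1 \<in> part 0; x\<^sub>2 \<in> part 0; x\<^sub>3 \<in> part 0\<rbrakk> \<Longrightarrow>
      x\<^sub>1 \<star> (x\<^sub>2 \<star> x\<^sub>3) = (x\<^sub>1 \<star> x\<^sub>2) \<star> x\<^sub>3"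
    and LA1: "\<lbrakk>x\<^sub>1 \<in> part 0; x\<^sub>2 \<in> part 0; y \<in> part 1\<rbrakk> \<Longrightarrow>
      x\<^sub>1 \<star> (x\<^sub>2 \<star> y) = (1 / 2) \<odot>\<^bsub>V\<^esub> ((x\<^sub>1 \<star> x\<^sub>2) \<star> y)"
    and LA2: "\<lbrakk>x \<in> part 0; y\<^sub>1 \<in> part 1; y\<^sub>2 \<in> part 1\<rbrakk> \<Longrightarrow>
      x \<star> (y\<^sub>1 \<star> y\<^sub>2) = (x \<star> y\<^sub>1) \<star> y\<^sub>2 \<oplus>\<^bsub>V\<^esub> y\<^sub>1 \<star> (x \<star> y\<^sub>2)"
    and LA3: "\<lbrakk>y\<^sub>1 \<in> part 1; y\<^sub>2 \<in> part 1; y\<^sub>3 \<in> part 1\<rbrakk> \<Longrightarrow>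
      y\<^sub>1 \<star> (y\<^sub>2 \<star> y\<^sub>3) \<oplus>\<^bsub>V\<^esub> y\<^sub>2 \<star> (y\<^sub>3 \<star> y\<^sub>1) \<oplus>\<^bsub>V\<^esub> y\<^sub>3 \<star> (y\<^sub>1 \<star> y\<^sub>2) = \<zero>\<^bsub>V\<^esub>"

locale lie_superalgebra = superalgebra V part br
  for V :: "('k::field, 'v) module" (structure) and part and br +
  assumes super_antisymmetry:
      "\<lbrakk>x \<in> part i; y \<in> part j\<rbrakk> \<Longrightarrow> br x y = (- parity_sign (i * j)) \<odot>\<^bsub>V\<^esub> br y x"
    and super_Jacobi:
      "\<lbrakk>x \<in> part i; y \<in> part j; z \<in> part l\<rbrakk> \<Longrightarrow>
        parity_sign (i * l) \<odot>\<^bsub>V\<^esub> br (br x y) z \<oplus>\<^bsub>V\<^esub>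
        parity_sign (j * i) \<odot>\<^bsub>V\<^esub> br (br y z) x \<oplus>\<^bsub>V\<^esub>
        parity_sign (l * j) \<odot>\<^bsub>V\<^esub> br (br z x) y = \<zero>\<^bsub>V\<^esub>"

definition linear_span :: "('k::field, 'v) module \<Rightarrow> 'v set \<Rightarrow> 'v set"
  where "linear_span V G = (\<lambda>N. submodule N (scalars :: 'k ring) V) hull G"

definition quotient_space :: "('k::field, 'v) module \<Rightarrow> 'v set \<Rightarrow> ('k, 'v set) module"
  where "quotient_space V N =
    \<lparr>carrier = a_rcosets\<^bsub>V\<^esub> N, monoid.mult = undefined, one = undefined,
     ring.zero = N, add = (<+>\<^bsub>V\<^esub>), module.smult = (\<lambda>k C. \<Union>v\<in>C. N +>\<^bsub>V\<^esub> (k \<odot>\<^bsub>V\<^esub> v))\<rparr>"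

definition free_space :: "'x set \<Rightarrow> ('k::field, 'x \<Rightarrow>\<^sub>0 'k) module"
  where "free_space B =
    \<lparr>carrier = {f. Poly_Mapping.keys f \<subseteq> B}, monoid.mult = undefined, one = undefined,
     ring.zero = 0, add = (+), module.smult = (\<lambda>k. Poly_Mapping.map ((*) k))\<rparr>"

definition direct_sum :: "('k::field, 'a) module \<Rightarrow> ('k, 'b) module \<Rightarrow> ('k, 'a \<times> 'b) module"
  where "direct_sum U V =
    \<lparr>carrier = carrier U \<times> carrier V, monoid.mult = undefined, one = undefined,
     ring.zero = (\<zero>\<^bsub>U\<^esub>, \<zero>\<^bsub>V\<^esub>),
     add = (\<lambda>(u, v) (u', v'). (u \<oplus>\<^bsub>U\<^esub> u', v \<oplus>\<^bsub>V\<^esub> v')),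
     module.smult = (\<lambda>k (u, v). (k \<odot>\<^bsub>U\<^esub> u, k \<odot>\<^bsub>V\<^esub> v))\<rparr>"

definition tensor_relations ::
    "('k::field, 'a) module \<Rightarrow> ('k, 'b) module \<Rightarrow> ('a \<times> 'b \<Rightarrow>\<^sub>0 'k) set"
  where "tensor_relations U V = linear_span (free_space (carrier U \<times> carrier V))
    ({Poly_Mapping.single (u \<oplus>\<^bsub>U\<^esub> u', v) 1 -
        (Poly_Mapping.single (u, v) 1 + Poly_Mapping.single (u', v) 1) | u u' v.
        u \<in> carrier U \<and> u' \<in> carrier U \<and> v \<in> carrier V} \<union>
     {Poly_Mapping.single (u, v \<oplus>\<^bsub>V\<^esub> v') 1 -
        (Poly_Mapping.single (u, v) 1 + Poly_Mapping.single (u, v') 1) | u v v'.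
        u \<in> carrier U \<and> v \<in> carrier V \<and> v' \<in> carrier V} \<union>
     {Poly_Mapping.single (k \<odot>\<^bsub>U\<^esub> u, v) 1 - Poly_Mapping.single (u, v) k | k u v.
        u \<in> carrier U \<and> v \<in> carrier V} \<union>
     {Poly_Mapping.single (u, k \<odot>\<^bsub>V\<^esub> v) 1 - Poly_Mapping.single (u, v) k | k u v.
        u \<in> carrier U \<and> v \<in> carrier V})"

definition tensor_space ::
    "('k::field, 'a) module \<Rightarrow> ('k, 'b) module \<Rightarrow> ('k, ('a \<times> 'b \<Rightarrow>\<^sub>0 'k) set) module"
  where "tensor_space U V =
    quotient_space (free_space (carrier U \<times> carrier V)) (tensor_relations U V)"

definition tensor ::
    "('k::field, 'a) module \<Rightarrow> ('k, 'b) module \<Rightarrow> 'a \<Rightarrow> 'b \<Rightarrow> ('a \<times> 'b \<Rightarrow>\<^sub>0 'k) set"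
  where "tensor U V u v =
    tensor_relations U V +>\<^bsub>free_space (carrier U \<times> carrier V)\<^esub> Poly_Mapping.single (u, v) 1"

abbreviation odd_space :: "('k::field, 'v) module \<Rightarrow> (bit \<Rightarrow> 'v set) \<Rightarrow> ('k, 'v) module"
  where "odd_space A part \<equiv> A\<lparr>carrier := part 1\<rparr>"

abbreviation odd_square ::
    "('k::field, 'v) module \<Rightarrow> (bit \<Rightarrow> 'v set) \<Rightarrow> ('k, ('v \<times> 'v \<Rightarrow>\<^sub>0 'k) set) module"
  where "odd_square A part \<equiv> tensor_space (odd_space A part) (odd_space A part)"

definition ga_relations ::
    "('k::field, 'v) module \<Rightarrow> (bit \<Rightarrow> 'v set) \<Rightarrow> ('v \<Rightarrow> 'v \<Rightarrow> 'v) \<Rightarrow> ('v \<times> 'v \<Rightarrow>\<^sub>0 'k) set set"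
  where "ga_relations A part mul =
    (let T = odd_square A part; tens = tensor (odd_space A part) (odd_space A part) in
     linear_span T
       ({tens a b \<ominus>\<^bsub>T\<^esub> tens b a | a b. a \<in> part 1 \<and> b \<in> part 1} \<union>
        {tens (mul a x) b \<ominus>\<^bsub>T\<^esub> tens a (mul b x) | a b x.
          a \<in> part 1 \<and> b \<in> part 1 \<and> x \<in> part 0}))"

definition ga_even ::
    "('k::field, 'v) module \<Rightarrow> (bit \<Rightarrow> 'v set) \<Rightarrow> ('v \<Rightarrow> 'v \<Rightarrow> 'v) \<Rightarrow>
      ('k, ('v \<times> 'v \<Rightarrow>\<^sub>0 'k) set set) module"
  where "ga_even A part mul = quotient_space (odd_square A part) (ga_relations A part mul)"

definition odot ::
    "('k::field, 'v) module \<Rightarrow> (bit \<Rightarrow> 'v set) \<Rightarrow> ('v \<Rightarrow> 'v \<Rightarrow> 'v) \<Rightarrow>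
      'v \<Rightarrow> 'v \<Rightarrow> ('v \<times> 'v \<Rightarrow>\<^sub>0 'k) set set"
  where "odot A part mul a b =
    ga_relations A part mul +>\<^bsub>odd_square A part\<^esub>
      tensor (odd_space A part) (odd_space A part) a b"

definition ga ::
    "('k::field, 'v) module \<Rightarrow> (bit \<Rightarrow> 'v set) \<Rightarrow> ('v \<Rightarrow> 'v \<Rightarrow> 'v) \<Rightarrow>
      ('k, ('v \<times> 'v \<Rightarrow>\<^sub>0 'k) set set \<times> 'v) module"
  where "ga A part mul = direct_sum (ga_even A part mul) (odd_space A part)"

definition ga_part ::
    "('k::field, 'v) module \<Rightarrow> (bit \<Rightarrow> 'v set) \<Rightarrow> ('v \<Rightarrow> 'v \<Rightarrow> 'v) \<Rightarrow>
      bit \<Rightarrow> (('v \<times> 'v \<Rightarrow>\<^sub>0 'k) set set \<times> 'v) set"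
  where "ga_part A part mul i =
    (if i = 0 then carrier (ga_even A part mul) \<times> {\<zero>\<^bsub>A\<^esub>}
     else {\<zero>\<^bsub>ga_even A part mul\<^esub>} \<times> part 1)"

text \<open>
  The bracket is only prescribed on generators, so that its existence (the formulas respect the
  relations defining the even part) is a property to be proved, not part of the definition.
\<close>

definition is_ga_bracket ::
    "('k::field, 'v) module \<Rightarrow> (bit \<Rightarrow> 'v set) \<Rightarrow> ('v \<Rightarrow> 'v \<Rightarrow> 'v) \<Rightarrow>
      (('v \<times> 'v \<Rightarrow>\<^sub>0 'k) set set \<times> 'v \<Rightarrow> ('v \<times> 'v \<Rightarrow>\<^sub>0 'k) set set \<times> 'v \<Rightarrow>
        ('v \<times> 'v \<Rightarrow>\<^sub>0 'k) set set \<times> 'v) \<Rightarrow> bool"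
  where "is_ga_bracket A part mul br \<longleftrightarrow>
    (let G = ga A part mul; G0 = ga_even A part mul; od = odot A part mul;
         in0 = (\<lambda>u. (u, \<zero>\<^bsub>A\<^esub>)); in1 = (\<lambda>y. (\<zero>\<^bsub>G0\<^esub>, y)) in
     bilinear_map G G G br \<and>
     (\<forall>a \<in> part 1. \<forall>b \<in> part 1. br (in1 a) (in1 b) = in0 (od a b)) \<and>
     (\<forall>a \<in> part 1. \<forall>b \<in> part 1. \<forall>c \<in> part 1.
       br (in0 (od a b)) (in1 c) = in1 (mul a (mul b c) \<oplus>\<^bsub>A\<^esub> mul b (mul a c)) \<and>
       br (in1 c) (in0 (od a b)) = in1 (\<ominus>\<^bsub>A\<^esub> (mul a (mul b c) \<oplus>\<^bsub>A\<^esub> mul b (mul a c)))) \<and>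
     (\<forall>a \<in> part 1. \<forall>b \<in> part 1. \<forall>c \<in> part 1. \<forall>d \<in> part 1.
       br (in0 (od a b)) (in0 (od c d)) =
         in0 (2 \<odot>\<^bsub>G0\<^esub> od (mul a (mul b c)) d \<oplus>\<^bsub>G0\<^esub> 2 \<odot>\<^bsub>G0\<^esub> od (mul b (mul a d)) c)))"

end

theory Submission
  imports Defs
begin

text \<open>
  For odd \<open>a, b\<close> put \<open>D\<^sub>a\<^sub>b c = a(bc) + b(ac)\<close>, an operator on the odd part. A linear computation
  from (LA1)--(LA3) gives two facts for even \<open>x\<close>: \<open>D\<close> respects the relation
  \<open>ax \<otimes> b = a \<otimes> bx\<close>, so \<open>D\<^sub>u\<close> makes sense for every \<open>u\<close> in the even part \<open>G\<^sub>0\<close> of the Lie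
  superalgebra, and the commutator of \<open>D\<^sub>a\<^sub>b\<close> with multiplication by \<open>x\<close> is multiplication by the
  even element \<open>a(xb) + b(xa)\<close>. The second fact shows that \<open>D\<^sub>u\<close> extends to \<open>G\<^sub>0\<close> by the Leibniz rule
  \<open>c \<odot> d \<mapsto> D\<^sub>u c \<odot> d + c \<odot> D\<^sub>u d\<close>, and (LA3) identifies this with the prescribed
  \<open>[u, c \<odot> d]\<close>. For \<open>x = de\<close> the element \<open>a(xb) + b(xa)\<close> equals \<open>(D\<^sub>a\<^sub>b d) e + d (D\<^sub>a\<^sub>b e)\<close>, whence
  \<open>[D\<^sub>u, D\<^sub>v] = D\<^bsub>[u, v]\<^esub>\<close>, which is the Jacobi identity with two even arguments; the one with three
  even arguments follows by the Leibniz rule.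
\<close>

section \<open>Linear algebra over a field type\<close>

lemma scalars_simps [simp]:
  "carrier (scalars :: 'k::field ring) = UNIV"
  "\<zero>\<^bsub>scalars :: 'k::field ring\<^esub> = 0"
  "\<one>\<^bsub>scalars :: 'k::field ring\<^esub> = 1"
  "k \<oplus>\<^bsub>scalars\<^esub> l = k + (l :: 'k::field)"
  "k \<otimes>\<^bsub>scalars\<^esub> l = k * (l :: 'k::field)"
  by (simp_all add: ring_of_type_algebra_def)

locale linear_space = module "scalars :: 'k::field ring" V
  for V :: "('k::field, 'v) module" (structure)
begin

lemma smult_carrier [simp, intro]: "v \<in> carrier V \<Longrightarrow> k \<odot> v \<in> carrier V"
  by simp

lemma smult_add_left: "v \<in> carrier V \<Longrightarrow> (k + l) \<odot> v = k \<odot> v \<oplus> l \<odot> v"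
  using smult_l_distr[of k l v] by simp

lemma smult_add_right:
  "v \<in> carrier V \<Longrightarrow> w \<in> carrier V \<Longrightarrow> k \<odot> (v \<oplus> w) = k \<odot> v \<oplus> k \<odot> w"
  using smult_r_distr[of k v w] by simp

lemma smult_mult: "v \<in> carrier V \<Longrightarrow> (k * l) \<odot> v = k \<odot> (l \<odot> v)"
  using smult_assoc1[of k l v] by simp

lemma smult_1 [simp]: "v \<in> carrier V \<Longrightarrow> 1 \<odot> v = v"
  using smult_one[of v] by simp

lemma smult_0 [simp]: "v \<in> carrier V \<Longrightarrow> 0 \<odot> v = \<zero>"
  using smult_l_null[of v] by simp

lemma smult_zero [simp]: "k \<odot> \<zero> = \<zero>"
  using smult_r_null[of k] by simp

lemma smult_neg_one: "v \<in> carrier V \<Longrightarrow> (- 1) \<odot> v = \<ominus> v"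
  using smult_add_left[of v "- 1" 1] by (simp add: minus_equality[symmetric])

lemma smult_two: "v \<in> carrier V \<Longrightarrow> 2 \<odot> v = v \<oplus> v"
  using smult_add_left[of v 1 1] by simp

lemma smult_neg: "v \<in> carrier V \<Longrightarrow> k \<odot> (\<ominus> v) = \<ominus> (k \<odot> v)"
  by (rule smult_r_minus) auto

lemma submodule_scalarsI:
  assumes "H \<subseteq> carrier V" "\<zero> \<in> H" "\<And>v w. v \<in> H \<Longrightarrow> w \<in> H \<Longrightarrow> v \<oplus> w \<in> H"
    and smul: "\<And>k v. v \<in> H \<Longrightarrow> k \<odot> v \<in> H"
  shows "submodule H scalars V"
proof (rule submoduleI)
  show "\<ominus> v \<in> H" if "v \<in> H" for v
    using smul[OF that, of "- 1"] that assms(1) by (auto simp: smult_neg_one)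
qed (use assms in auto)

text \<open>The hull is the intersection of all submodules that contain \<open>G\<close>. The
  hypothesis makes \<open>carrier V\<close> one of them; otherwise the intersection would range over
  an empty family and be \<open>UNIV\<close>.\<close>

lemma linear_span_submodule:
  assumes "G \<subseteq> carrier V"
  shows "submodule (linear_span V G) scalars V"
proof (rule submodule_scalarsI)
  have c: "submodule (carrier V) scalars V" by (rule carrier_is_submodule)
  show "linear_span V G \<subseteq> carrier V"
    unfolding linear_span_def by (rule hull_minimal) (use assms c in auto)
  show "\<zero> \<in> linear_span V G"
    unfolding linear_span_def hull_def
    using subgroup.one_closed[OF submodule.axioms(1)] by fastforce
  show "v \<oplus> w \<in> linear_span V G" if "v \<in> linear_span V G" "w \<in> linear_span V G" for v w
    using that submoduleE(5) unfolding linear_span_def hull_def by auto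
  show "k \<odot> v \<in> linear_span V G" if "v \<in> linear_span V G" for k v
    using that submoduleE(4) unfolding linear_span_def hull_def by auto
qed

end

section \<open>Linear and bilinear maps, and their behaviour on spans\<close>

definition linear_map ::
    "('k::field, 'a) module \<Rightarrow> ('k, 'b) module \<Rightarrow> ('a \<Rightarrow> 'b) \<Rightarrow> bool"
  where "linear_map U V f \<longleftrightarrow>
    (\<forall>u \<in> carrier U. f u \<in> carrier V) \<and>
    (\<forall>u \<in> carrier U. \<forall>u' \<in> carrier U. f (u \<oplus>\<^bsub>U\<^esub> u') = f u \<oplus>\<^bsub>V\<^esub> f u') \<and>
    (\<forall>k. \<forall>u \<in> carrier U. f (k \<odot>\<^bsub>U\<^esub> u) = k \<odot>\<^bsub>V\<^esub> f u)"

lemma linear_mapI: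
  assumes "\<And>u. u \<in> carrier U \<Longrightarrow> f u \<in> carrier V"
    and "\<And>u u'. u \<in> carrier U \<Longrightarrow> u' \<in> carrier U \<Longrightarrow> f (u \<oplus>\<^bsub>U\<^esub> u') = f u \<oplus>\<^bsub>V\<^esub> f u'"
    and "\<And>k u. u \<in> carrier U \<Longrightarrow> f (k \<odot>\<^bsub>U\<^esub> u) = k \<odot>\<^bsub>V\<^esub> f u"
  shows "linear_map U V f"
  using assms unfolding linear_map_def by blast

lemma linear_mapD:
  assumes "linear_map U V f"
  shows linear_map_closed: "u \<in> carrier U \<Longrightarrow> f u \<in> carrier V"
    and linear_map_add: "u \<in> carrier U \<Longrightarrow> u' \<in> carrier U \<Longrightarrow> f (u \<oplus>\<^bsub>U\<^esub> u') = f u \<oplus>\<^bsub>V\<^esub> f u'"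
    and linear_map_smult: "u \<in> carrier U \<Longrightarrow> f (k \<odot>\<^bsub>U\<^esub> u) = k \<odot>\<^bsub>V\<^esub> f u"
  using assms unfolding linear_map_def by blast+

lemma bilinear_mapI:
  assumes "\<And>v. v \<in> carrier V \<Longrightarrow> linear_map U W (\<lambda>u. f u v)"
    and "\<And>u. u \<in> carrier U \<Longrightarrow> linear_map V W (f u)"
  shows "bilinear_map U V W f"
  using assms unfolding bilinear_map_def linear_map_def by blast

lemma
  assumes "bilinear_map U V W f"
  shows bilinear_map_left: "v \<in> carrier V \<Longrightarrow> linear_map U W (\<lambda>u. f u v)"
    and bilinear_map_right: "u \<in> carrier U \<Longrightarrow> linear_map V W (f u)"
  using assms unfolding bilinear_map_def linear_map_def by blast+

lemma linear_map_zero: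
  assumes "linear_space U" "linear_space W" "linear_map U W f"
  shows "f \<zero>\<^bsub>U\<^esub> = \<zero>\<^bsub>W\<^esub>"
proof -
  interpret U: linear_space U by fact
  interpret W: linear_space W by fact
  have "f (0 \<odot>\<^bsub>U\<^esub> \<zero>\<^bsub>U\<^esub>) = 0 \<odot>\<^bsub>W\<^esub> f \<zero>\<^bsub>U\<^esub>"
    using linear_mapD[OF assms(3)] by blast
  then show ?thesis
    using linear_map_closed[OF assms(3)] by simp
qed

lemma linear_map_minus:
  assumes "linear_space U" "linear_space W" "linear_map U W f" "u \<in> carrier U"
  shows "f (\<ominus>\<^bsub>U\<^esub> u) = \<ominus>\<^bsub>W\<^esub> f u"
  using linear_mapD[OF assms(3)] assms(4)
  by (metis linear_space.smult_neg_one[OF assms(1)] linear_space.smult_neg_one[OF assms(2)])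

text \<open>The equaliser of \<open>f\<close> and \<open>g\<close> is a submodule, so it contains
  the span once it contains \<open>G\<close>. With \<open>g\<close> the zero map, this is how maps
  are shown to kill the relations of the tensor product and of the even part.\<close>

lemma linear_map_eq_on_span:
  assumes "linear_space U" "linear_space W" "linear_map U W f" "linear_map U W g"
    and "G \<subseteq> carrier U" "\<And>u. u \<in> G \<Longrightarrow> f u = g u" "u \<in> linear_span U G"
  shows "f u = g u"
proof -
  interpret U: linear_space U by fact
  interpret W: linear_space W by fact
  note [simp] = linear_mapD[OF assms(3)] linear_mapD[OF assms(4)]
  have "submodule {u \<in> carrier U. f u = g u} scalars U"
    by (rule U.submodule_scalarsI)
      (auto simp: linear_map_zero[OF assms(1-3)] linear_map_zero[OF assms(1,2,4)])
  moreover have "G \<subseteq> {u \<in> carrier U. f u = g u}"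
    using assms by auto
  ultimately have "linear_span U G \<subseteq> {u \<in> carrier U. f u = g u}"
    unfolding linear_span_def by (intro hull_minimal)
  then show ?thesis using assms(7) by blast
qed

lemma linear_map_const_zero:
  assumes "linear_space W"
  shows "linear_map U W (\<lambda>_. \<zero>\<^bsub>W\<^esub>)"
proof -
  interpret W: linear_space W by fact
  show ?thesis by (rule linear_mapI) auto
qed

text \<open>The elements that \<open>f\<close> sends into the span of the image form a submodule
  containing \<open>G\<close>. Applied to coset projections, this carries generators to a
  quotient.\<close>

lemma linear_map_image_span:
  assumes "linear_space U" "linear_space W" "linear_map U W f" "G \<subseteq> carrier U"
    and "u \<in> linear_span U G"
  shows "f u \<in> linear_span W (f ` G)"
proof -
  interpret U: linear_space U by fact
  interpret W: linear_space W by fact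
  have fG: "f ` G \<subseteq> carrier W"
    using assms(4) linear_map_closed[OF assms(3)] by auto
  note sub = W.linear_span_submodule[OF fG]
  have "submodule {u \<in> carrier U. f u \<in> linear_span W (f ` G)} scalars U"
  proof (rule U.submodule_scalarsI)
    show "\<zero>\<^bsub>U\<^esub> \<in> {u \<in> carrier U. f u \<in> linear_span W (f ` G)}"
      using subgroup.one_closed[OF submodule.axioms(1)[OF sub]]
      by (simp add: linear_map_zero[OF assms(1-3)])
  qed (use W.submoduleE(4,5)[OF sub] in \<open>auto simp: linear_mapD[OF assms(3)]\<close>)
  moreover have "G \<subseteq> {u \<in> carrier U. f u \<in> linear_span W (f ` G)}"
    using assms(4) by (auto simp: linear_span_def intro: hull_inc)
  ultimately have "linear_span U G \<subseteq> {u \<in> carrier U. f u \<in> linear_span W (f ` G)}"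
    unfolding linear_span_def by (intro hull_minimal)
  then show ?thesis using assms(5) by blast
qed

section \<open>Quotient spaces and their universal property\<close>

locale quotient_by = linear_space V
  for V :: "('k::field, 'v) module" (structure) +
  fixes N
  assumes N_submodule: "submodule N scalars V"
begin

sublocale N: abelian_subgroup N V
  by (rule abelian_subgroupI3)
    (auto simp: additive_subgroup_def
      intro: submodule.axioms(1)[OF N_submodule] abelian_group_axioms)

abbreviation "Q \<equiv> quotient_space V N"

lemma quotient_carrier: "carrier Q = (\<lambda>v. N +> v) ` carrier V"
  by (auto simp: quotient_space_def A_RCOSETS_def' a_r_coset_def')

lemma quotient_zero: "\<zero>\<^bsub>Q\<^esub> = N"
  by (simp add: quotient_space_def)

lemma coset_zero: "N +> \<zero> = N"
  by (simp add: N.a_subset)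

lemma coset_eq_iff:
  assumes "v \<in> carrier V" "w \<in> carrier V"
  shows "N +> v = N +> w \<longleftrightarrow> v \<ominus> w \<in> N"
  using assms N.a_rcos_module[of w v] N.a_repr_independence'[of v w] N.a_rcos_self[of v]
  by (auto simp: a_minus_def)

lemma coset_add:
  "v \<in> carrier V \<Longrightarrow> w \<in> carrier V \<Longrightarrow> (N +> v) \<oplus>\<^bsub>Q\<^esub> (N +> w) = N +> (v \<oplus> w)"
  by (simp add: quotient_space_def N.a_rcos_sum)

text \<open>In \<open>quotient_space\<close> a multiple of a coset is a union of cosets over all
  elements of that coset. Since \<open>N\<close> is closed under scaling, these cosets coincide and
  the union is a single one.\<close>

lemma coset_smult:
  assumes v: "v \<in> carrier V"
  shows "k \<odot>\<^bsub>Q\<^esub> (N +> v) = N +> (k \<odot> v)"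
proof -
  have "N +> (k \<odot> w) = N +> (k \<odot> v)" if w: "w \<in> N +> v" for w
  proof -
    have wc: "w \<in> carrier V" using N.a_elemrcos_carrier v w by blast
    have "w \<ominus> v \<in> N" using N.a_rcos_module[OF v wc] w by (simp add: a_minus_def)
    then have "k \<odot> (w \<ominus> v) \<in> N"
      using submoduleE(4)[OF N_submodule, of k "w \<ominus> v"] by simp
    then show ?thesis
      using v wc by (subst coset_eq_iff) (auto simp: a_minus_def smult_add_right smult_neg)
  qed
  moreover have "v \<in> N +> v" using v N.a_rcos_self by blast
  ultimately have "(\<Union>w\<in>N +> v. N +> (k \<odot> w)) = N +> (k \<odot> v)" by blast
  then show ?thesis by (simp add: quotient_space_def)
qed

lemma quotient_linear_space: "linear_space Q"
proof -
  have c: "\<exists>v \<in> carrier V. C = N +> v" if "C \<in> carrier Q" for C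
    using that quotient_carrier by auto
  have m: "N +> v \<in> carrier Q" if "v \<in> carrier V" for v
    using that quotient_carrier by auto
  have "abelian_group Q"
  proof (rule abelian_groupI)
    show "\<zero>\<^bsub>Q\<^esub> \<in> carrier Q"
      using m[of \<zero>] by (simp add: quotient_zero coset_zero)
    show "\<zero>\<^bsub>Q\<^esub> \<oplus>\<^bsub>Q\<^esub> C = C" if "C \<in> carrier Q" for C
      using c[OF that] coset_add[of \<zero>] by (auto simp: quotient_zero coset_zero)
    show "\<exists>D \<in> carrier Q. D \<oplus>\<^bsub>Q\<^esub> C = \<zero>\<^bsub>Q\<^esub>" if C: "C \<in> carrier Q" for C
    proof -
      obtain v where v: "v \<in> carrier V" "C = N +> v" using c[OF C] by blast
      then have "(N +> (\<ominus> v)) \<oplus>\<^bsub>Q\<^esub> C = \<zero>\<^bsub>Q\<^esub>"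
        by (simp add: coset_add quotient_zero coset_zero l_neg)
      then show ?thesis using m[of "\<ominus> v"] v by blast
    qed
    show "B \<oplus>\<^bsub>Q\<^esub> C \<in> carrier Q" if "B \<in> carrier Q" "C \<in> carrier Q" for B C
      using c[OF that(1)] c[OF that(2)] m by (auto simp: coset_add)
    show "B \<oplus>\<^bsub>Q\<^esub> C = C \<oplus>\<^bsub>Q\<^esub> B" if "B \<in> carrier Q" "C \<in> carrier Q" for B C
      using c[OF that(1)] c[OF that(2)] by (auto simp: coset_add a_comm)
    show "B \<oplus>\<^bsub>Q\<^esub> C \<oplus>\<^bsub>Q\<^esub> D = B \<oplus>\<^bsub>Q\<^esub> (C \<oplus>\<^bsub>Q\<^esub> D)"
      if "B \<in> carrier Q" "C \<in> carrier Q" "D \<in> carrier Q" for B C D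
      using c[OF that(1)] c[OF that(2)] c[OF that(3)] by (auto simp: coset_add a_assoc)
  qed
  then have "module scalars Q"
    by (rule moduleI[OF R.is_cring])
      (auto dest!: c intro!: m simp: coset_add coset_smult
        smult_add_left smult_add_right smult_mult)
  then show ?thesis by (rule linear_space.intro)
qed

lemma coset_linear: "linear_map V Q (\<lambda>v. N +> v)"
  by (rule linear_mapI) (auto simp: coset_add coset_smult quotient_carrier)

text \<open>The map evaluates \<open>f\<close> at a chosen representative. Two representatives
  differ by an element of \<open>N\<close>, where \<open>f\<close> vanishes, so the choice is
  immaterial and linearity passes to cosets.\<close>

lemma quotient_lift:
  assumes "linear_space W" "linear_map V W f" "\<And>v. v \<in> N \<Longrightarrow> f v = \<zero>\<^bsub>W\<^esub>"
  shows "\<exists>g. linear_map Q W g \<and> (\<forall>v \<in> carrier V. g (N +> v) = f v)"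
proof (intro exI conjI ballI)
  interpret W: linear_space W by fact
  let ?g = "\<lambda>C. f (SOME v. v \<in> carrier V \<and> C = N +> v)"
  show g: "?g (N +> v) = f v" if v: "v \<in> carrier V" for v
  proof -
    define w where "w = (SOME w. w \<in> carrier V \<and> N +> v = N +> w)"
    have w: "w \<in> carrier V \<and> N +> v = N +> w"
      unfolding w_def by (rule someI[of _ v]) (use v in simp)
    then have "f (w \<ominus> v) = \<zero>\<^bsub>W\<^esub>" using coset_eq_iff[of w v] v assms(3) by auto
    then have "f w \<ominus>\<^bsub>W\<^esub> f v = \<zero>\<^bsub>W\<^esub>"
      using w v linear_map_minus[OF linear_space_axioms assms(1,2)]
      by (simp add: a_minus_def linear_mapD[OF assms(2)])
    then have "f w = f v"
      using w v linear_map_closed[OF assms(2)] W.minus_equality[of "f w" "\<ominus>\<^bsub>W\<^esub> f v"]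
      by (simp add: a_minus_def)
    then show ?thesis unfolding w_def .
  qed
  show "linear_map Q W ?g"
    by (rule linear_mapI)
      (auto simp: quotient_carrier coset_add coset_smult g linear_mapD[OF assms(2)])
qed

lemma quotient_span:
  assumes "G \<subseteq> carrier V" "linear_span V G = carrier V"
  shows "linear_span Q ((\<lambda>v. N +> v) ` G) = carrier Q"
proof
  interpret Q: linear_space Q by (rule quotient_linear_space)
  show "linear_span Q ((\<lambda>v. N +> v) ` G) \<subseteq> carrier Q"
    by (rule Q.submoduleE(1)[OF Q.linear_span_submodule])
      (use assms(1) quotient_carrier in auto)
  show "carrier Q \<subseteq> linear_span Q ((\<lambda>v. N +> v) ` G)"
    using linear_map_image_span[OF linear_space_axioms quotient_linear_space coset_linear
        assms(1)] assms(2)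
    by (auto simp: quotient_carrier)
qed

end

section \<open>Free spaces of finitely supported functions\<close>

lemma free_space_simps [simp]:
  "carrier (free_space B) = {f. Poly_Mapping.keys f \<subseteq> B}"
  "\<zero>\<^bsub>free_space B\<^esub> = 0"
  "f \<oplus>\<^bsub>free_space B\<^esub> g = f + g"
  "k \<odot>\<^bsub>free_space B\<^esub> f = Poly_Mapping.map ((*) k) f"
  by (simp_all add: free_space_def)

text \<open>\<open>Poly_Mapping.map\<close> applies its function to nonzero coefficients only; this
  agrees with scaling everywhere because multiples of zero vanish.\<close>

lemma lookup_map_mult [simp]:
  "Poly_Mapping.lookup (Poly_Mapping.map ((*) k) f) x = k * Poly_Mapping.lookup f x"
  for k :: "'k::field"
  by (simp add: Poly_Mapping.map.rep_eq when_def)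

lemma keys_map_mult: "Poly_Mapping.keys (Poly_Mapping.map ((*) k) f) \<subseteq> Poly_Mapping.keys f"
  for k :: "'k::field"
  by (auto simp: in_keys_iff)

lemma map_mult_single [simp]:
  "Poly_Mapping.map ((*) k) (Poly_Mapping.single x l) = Poly_Mapping.single x (k * l)"
  for k :: "'k::field"
  by (rule poly_mapping_eqI) (simp add: lookup_single when_def)

lemma free_linear_space: "linear_space (free_space B :: ('k::field, 'x \<Rightarrow>\<^sub>0 'k) module)"
proof -
  let ?F = "free_space B :: ('k::field, 'x \<Rightarrow>\<^sub>0 'k) module"
  have "abelian_group ?F"
  proof (rule abelian_groupI)
    show "\<exists>g \<in> carrier ?F. g \<oplus>\<^bsub>?F\<^esub> f = \<zero>\<^bsub>?F\<^esub>" if "f \<in> carrier ?F" for f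
      using that by (intro bexI[of _ "- f"]) (auto simp: in_keys_iff)
    show "f \<oplus>\<^bsub>?F\<^esub> g \<in> carrier ?F" if "f \<in> carrier ?F" "g \<in> carrier ?F" for f g
      using that keys_add[of f g] by auto
  qed (auto simp: add_ac)
  then have "module scalars ?F"
  proof (rule moduleI[OF cring_from_type_algebra])
    show "k \<odot>\<^bsub>?F\<^esub> f \<in> carrier ?F" if "f \<in> carrier ?F" for k f
      using that keys_map_mult[of k f] by auto
  qed (auto intro!: poly_mapping_eqI simp: lookup_add distrib_left distrib_right mult.assoc)
  then show ?thesis by (rule linear_space.intro)
qed

text \<open>The tensor relations are written with the subtraction of the type, the coset lemmas with
  the inverse of the module record; this reconciles the two.\<close>

lemma free_space_a_inv:
  assumes "f \<in> carrier (free_space B)"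
  shows "\<ominus>\<^bsub>free_space B\<^esub> f = - (f :: 'x \<Rightarrow>\<^sub>0 'k::field)"
proof -
  interpret F: linear_space "free_space B :: ('k, 'x \<Rightarrow>\<^sub>0 'k) module" by (rule free_linear_space)
  have "- f \<in> carrier (free_space B)" using assms by (auto simp: in_keys_iff)
  then show ?thesis using F.minus_equality[of "- f" f] assms by simp
qed

lemma free_space_span:
  "linear_span (free_space B) ((\<lambda>x. Poly_Mapping.single x 1) ` B) =
    carrier (free_space B :: ('k::field, 'x \<Rightarrow>\<^sub>0 'k) module)"
proof
  let ?F = "free_space B :: ('k::field, 'x \<Rightarrow>\<^sub>0 'k) module"
  let ?G = "(\<lambda>x. Poly_Mapping.single x 1 :: 'x \<Rightarrow>\<^sub>0 'k) ` B"
  interpret F: linear_space ?F by (rule free_linear_space)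
  have sub: "submodule (linear_span ?F ?G) scalars ?F"
    by (rule F.linear_span_submodule) auto
  show "linear_span ?F ?G \<subseteq> carrier ?F" by (rule F.submoduleE(1)[OF sub])
  have "f \<in> linear_span ?F ?G" if "Poly_Mapping.keys f \<subseteq> B" for f
  proof -
    have *: "Poly_Mapping.single x k \<in> linear_span ?F ?G" if "x \<in> B" for x k
    proof -
      have "Poly_Mapping.single x 1 \<in> linear_span ?F ?G"
        using that by (auto simp: linear_span_def intro: hull_inc)
      from F.submoduleE(4)[OF sub _ this, of k] show ?thesis by simp
    qed
    \<comment> \<open>The induction covers every finite subset of \<open>B\<close>; for the support
      of \<open>f\<close> the sum is \<open>f\<close> itself.\<close>
    have "(\<Sum>x\<in>S. Poly_Mapping.single x (Poly_Mapping.lookup f x)) \<in> linear_span ?F ?G"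
      if "finite S" "S \<subseteq> B" for S
      using that
    proof (induction S rule: finite_induct)
      case empty
      then show ?case using subgroup.one_closed[OF submodule.axioms(1)[OF sub]] by simp
    next
      case (insert x S)
      then show ?case using F.submoduleE(5)[OF sub] * by fastforce
    qed
    moreover have "(\<Sum>x\<in>Poly_Mapping.keys f. Poly_Mapping.single x (Poly_Mapping.lookup f x)) = f"
      by (rule poly_mapping_eqI) (auto simp: lookup_sum lookup_single when_def in_keys_iff)
    ultimately show ?thesis using that by (metis finite_keys)
  qed
  then show "carrier ?F \<subseteq> linear_span ?F ?G" by auto
qed

lemma free_lift:
  fixes W :: "('k::field, 'w) module" and f :: "'x \<Rightarrow> 'w"
  assumes "linear_space W" "\<And>x. x \<in> B \<Longrightarrow> f x \<in> carrier W"
  shows "\<exists>g. linear_map (free_space B) W g \<and> (\<forall>x \<in> B. g (Poly_Mapping.single x 1) = f x)"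
proof (intro exI conjI ballI)
  interpret W: linear_space W by fact
  let ?g = "\<lambda>p. \<Oplus>\<^bsub>W\<^esub>x\<in>Poly_Mapping.keys p. Poly_Mapping.lookup p x \<odot>\<^bsub>W\<^esub> f x"
  \<comment> \<open>Indices outside the support have coefficient zero, so the sum may range over any
    finite \<open>S\<close> between the support and \<open>B\<close>. Sums with different supports
    can then be compared over a common index set.\<close>
  have ext: "?g p = (\<Oplus>\<^bsub>W\<^esub>x\<in>S. Poly_Mapping.lookup p x \<odot>\<^bsub>W\<^esub> f x)"
    if "finite S" "Poly_Mapping.keys p \<subseteq> S" "S \<subseteq> B" for p S
    using that assms(2)
    by (intro W.add.finprod_mono_neutral_cong_left) (auto simp: in_keys_iff)
  show "linear_map (free_space B) W ?g"
  proof (rule linear_mapI)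
    fix p q :: "'x \<Rightarrow>\<^sub>0 'k" and k
    assume p: "p \<in> carrier (free_space B)"
    show "?g p \<in> carrier W"
      using p assms(2) by (intro W.finsum_closed) auto
    have "?g (Poly_Mapping.map ((*) k) p) =
        (\<Oplus>\<^bsub>W\<^esub>x\<in>Poly_Mapping.keys p. k \<odot>\<^bsub>W\<^esub> (Poly_Mapping.lookup p x \<odot>\<^bsub>W\<^esub> f x))"
      using p assms(2) keys_map_mult[of k p]
      by (subst ext[of "Poly_Mapping.keys p"])
        (auto intro!: W.finsum_cong' simp: W.smult_mult subset_iff)
    then show "?g (k \<odot>\<^bsub>free_space B\<^esub> p) = k \<odot>\<^bsub>W\<^esub> ?g p"
      using p assms(2) W.finsum_smult_ldistr[of "Poly_Mapping.keys p" k]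
      by (auto simp: Pi_def subset_iff)
    assume q: "q \<in> carrier (free_space B)"
    let ?S = "Poly_Mapping.keys p \<union> Poly_Mapping.keys q"
    have *: "Poly_Mapping.keys p \<subseteq> B \<and> Poly_Mapping.keys q \<subseteq> B"
      using p q by simp
    have "?g (p + q) =
        (\<Oplus>\<^bsub>W\<^esub>x\<in>?S. Poly_Mapping.lookup p x \<odot>\<^bsub>W\<^esub> f x \<oplus>\<^bsub>W\<^esub> Poly_Mapping.lookup q x \<odot>\<^bsub>W\<^esub> f x)"
      unfolding ext[of ?S "p + q", OF _ keys_add, simplified, OF *]
      using p q assms(2) by (intro W.finsum_cong') (auto simp: lookup_add W.smult_add_left)
    also have "\<dots> = ?g p \<oplus>\<^bsub>W\<^esub> ?g q"
      using p q assms(2)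
      by (subst W.finsum_addf) (auto simp: ext[of ?S] subset_iff)
    finally show "?g (p \<oplus>\<^bsub>free_space B\<^esub> q) = ?g p \<oplus>\<^bsub>W\<^esub> ?g q" by simp
  qed
  show "?g (Poly_Mapping.single x 1) = f x" if "x \<in> B" for x
    using that assms(2) by (simp add: W.finsum_insert)
qed

lemma linear_map_free_diff:
  fixes W :: "('k::field, 'w) module" and B :: "'x set"
  assumes "linear_space W" "linear_map (free_space B) W g"
    and "p \<in> carrier (free_space B)" "q \<in> carrier (free_space B)"
  shows "g (p - q) = g p \<ominus>\<^bsub>W\<^esub> g q"
proof -
  interpret F: linear_space "free_space B :: ('k, 'x \<Rightarrow>\<^sub>0 'k) module" by (rule free_linear_space)
  have "p - q = p \<oplus>\<^bsub>free_space B\<^esub> (\<ominus>\<^bsub>free_space B\<^esub> q)"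
    using free_space_a_inv[OF assms(4)] by simp
  then have "g (p - q) = g p \<oplus>\<^bsub>W\<^esub> g (\<ominus>\<^bsub>free_space B\<^esub> q)"
    using linear_map_add[OF assms(2) assms(3) F.a_inv_closed[OF assms(4)]] by (simp only:)
  then show ?thesis
    using linear_map_minus[OF free_linear_space assms(1,2,4)] by (simp add: a_minus_def)
qed

lemma linear_map_free_single:
  assumes "linear_map (free_space B) W g" "x \<in> B"
  shows "g (Poly_Mapping.single x k) = k \<odot>\<^bsub>W\<^esub> g (Poly_Mapping.single x 1)"
  using linear_map_smult[OF assms(1), of "Poly_Mapping.single x 1" k] assms(2) by simp

section \<open>Tensor products as quotients of free spaces\<close>

locale tensor_product = U: linear_space U + V: linear_space V
  for U :: "('k::field, 'a) module" and V :: "('k, 'b) module"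
begin

abbreviation "B \<equiv> carrier U \<times> carrier V"
abbreviation F :: "('k, 'a \<times> 'b \<Rightarrow>\<^sub>0 'k) module" where "F \<equiv> free_space B"

sublocale F: linear_space F by (rule free_linear_space)

lemma single_in_F: "u \<in> carrier U \<Longrightarrow> v \<in> carrier V \<Longrightarrow> Poly_Mapping.single (u, v) k \<in> carrier F"
  by simp

lemma diff_in_F: "p \<in> carrier F \<Longrightarrow> q \<in> carrier F \<Longrightarrow> p - q \<in> carrier F"
  using F.minus_closed[of p q] by (simp add: a_minus_def free_space_a_inv)

lemma add_in_F: "p \<in> carrier F \<Longrightarrow> q \<in> carrier F \<Longrightarrow> p + q \<in> carrier F"
  using F.a_closed[of p q] by simp

lemmas in_F = single_in_F diff_in_F add_in_F U.a_closed V.a_closed U.smult_carrier V.smult_carrier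

sublocale Q: quotient_by F "tensor_relations U V"
proof (intro quotient_by.intro quotient_by_axioms.intro F.linear_space_axioms)
  show "submodule (tensor_relations U V) scalars F"
    unfolding tensor_relations_def
    by (rule F.linear_span_submodule)
      (intro Un_least subsetI; elim CollectE exE conjE; simp only: in_F)
qed

lemma tensor_space_eq: "tensor_space U V = Q.Q"
  by (simp add: tensor_space_def)

lemma tensor_linear_space: "linear_space (tensor_space U V)"
  unfolding tensor_space_eq by (rule Q.quotient_linear_space)

lemma coset_eqI:
  assumes "p \<in> carrier F" "q \<in> carrier F" "p - q \<in> tensor_relations U V"
  shows "tensor_relations U V +>\<^bsub>F\<^esub> p = tensor_relations U V +>\<^bsub>F\<^esub> q"
  using Q.coset_eq_iff[OF assms(1,2)] assms(3) free_space_a_inv[OF assms(2)]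
  by (simp add: a_minus_def)

text \<open>Each identity states that two cosets agree, and the difference of their representatives
  is a generator of \<open>tensor_relations\<close>.\<close>

lemma tensor_bilinear: "bilinear_map U V (tensor_space U V) (tensor U V)"
proof (intro bilinear_mapI linear_mapI)
  fix u u' v v' k
  assume u: "u \<in> carrier U" and v: "v \<in> carrier V"
  show "tensor U V u v \<in> carrier (tensor_space U V)"
    and "tensor U V u v \<in> carrier (tensor_space U V)"
    using u v by (auto simp: tensor_def tensor_space_eq Q.quotient_carrier intro!: imageI)
  show "tensor U V (k \<odot>\<^bsub>U\<^esub> u) v = k \<odot>\<^bsub>tensor_space U V\<^esub> tensor U V u v"
    unfolding tensor_def tensor_space_eq Q.coset_smult[OF single_in_F[OF u v]]
    using u v in_F
    by (intro coset_eqI) (auto simp: tensor_relations_def linear_span_def intro!: hull_inc)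
  show "tensor U V u (k \<odot>\<^bsub>V\<^esub> v) = k \<odot>\<^bsub>tensor_space U V\<^esub> tensor U V u v"
    unfolding tensor_def tensor_space_eq Q.coset_smult[OF single_in_F[OF u v]]
    using u v in_F
    by (intro coset_eqI) (auto simp: tensor_relations_def linear_span_def intro!: hull_inc)
  show "tensor U V (u \<oplus>\<^bsub>U\<^esub> u') v = tensor U V u v \<oplus>\<^bsub>tensor_space U V\<^esub> tensor U V u' v"
    if u': "u' \<in> carrier U"
    unfolding tensor_def tensor_space_eq Q.coset_add[OF single_in_F[OF u v] single_in_F[OF u' v]]
  proof (rule coset_eqI)
    show "Poly_Mapping.single (u \<oplus>\<^bsub>U\<^esub> u', v) 1 -
        (Poly_Mapping.single (u, v) 1 \<oplus>\<^bsub>F\<^esub> Poly_Mapping.single (u', v) 1) \<in> tensor_relations U V"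
      using u u' v by (auto simp: tensor_relations_def linear_span_def intro!: hull_inc)
  qed (use u u' v in \<open>simp_all only: in_F free_space_simps(3)\<close>)
  show "tensor U V u (v \<oplus>\<^bsub>V\<^esub> v') = tensor U V u v \<oplus>\<^bsub>tensor_space U V\<^esub> tensor U V u v'"
    if v': "v' \<in> carrier V"
    unfolding tensor_def tensor_space_eq Q.coset_add[OF single_in_F[OF u v] single_in_F[OF u v']]
  proof (rule coset_eqI)
    show "Poly_Mapping.single (u, v \<oplus>\<^bsub>V\<^esub> v') 1 -
        (Poly_Mapping.single (u, v) 1 \<oplus>\<^bsub>F\<^esub> Poly_Mapping.single (u, v') 1) \<in> tensor_relations U V"
      using u v v' by (auto simp: tensor_relations_def linear_span_def intro!: hull_inc)
  qed (use u v v' in \<open>simp_all only: in_F free_space_simps(3)\<close>)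
qed

text \<open>\<open>f\<close> extends linearly from the basis of pairs to the free space. Bilinearity
  makes the extension vanish on the four families of relations, so it descends to the
  quotient.\<close>

lemma tensor_lift:
  assumes W: "linear_space W" and f: "bilinear_map U V W f"
  shows "\<exists>g. linear_map (tensor_space U V) W g \<and>
    (\<forall>u \<in> carrier U. \<forall>v \<in> carrier V. g (tensor U V u v) = f u v)"
proof -
  interpret W: linear_space W by fact
  note l = bilinear_map_left[OF f] and r = bilinear_map_right[OF f]
  have f_closed: "f u v \<in> carrier W" if "u \<in> carrier U" "v \<in> carrier V" for u v
    using that linear_map_closed[OF r] by blast
  obtain g where g: "linear_map F W g" "\<And>x. x \<in> B \<Longrightarrow> g (Poly_Mapping.single x 1) = f (fst x) (snd x)"
    using free_lift[OF W, of B "\<lambda>x. f (fst x) (snd x)"] f_closed by auto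
  have s: "g (Poly_Mapping.single (u, v) k) = k \<odot>\<^bsub>W\<^esub> f u v"
    if "u \<in> carrier U" "v \<in> carrier V" for u v k
    using linear_map_free_single[OF g(1), of "(u, v)" k] g(2)[of "(u, v)"] that by simp
  note d = linear_map_free_diff[OF W g(1)]
  have a: "g (p + q) = g p \<oplus>\<^bsub>W\<^esub> g q" if "p \<in> carrier F" "q \<in> carrier F" for p q
    using linear_map_add[OF g(1) that] by simp
  have "g p = \<zero>\<^bsub>W\<^esub>" if "p \<in> tensor_relations U V" for p
  proof (rule linear_map_eq_on_span[OF F.linear_space_axioms W g(1) linear_map_const_zero[OF W] _ _
      that[unfolded tensor_relations_def]], goal_cases)
    case 1
    show ?case
      by (intro Un_least subsetI; elim CollectE exE conjE; simp only: in_F)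
  next
    case (2 u)
    then show ?case
      by (elim UnE CollectE exE conjE; simp only: in_F d a s
          linear_map_add[OF l] linear_map_add[OF r]
          linear_map_smult[OF l] linear_map_smult[OF r] f_closed W.smult_1 W.r_neg a_minus_def
          W.a_closed W.smult_carrier)
  qed
  from Q.quotient_lift[OF W g(1) this] obtain h where h: "linear_map Q.Q W h"
    "\<And>p. p \<in> carrier F \<Longrightarrow> h (tensor_relations U V +>\<^bsub>F\<^esub> p) = g p"
    by blast
  then have "\<forall>u \<in> carrier U. \<forall>v \<in> carrier V. h (tensor U V u v) = f u v"
    using g(2) by (simp add: tensor_def)
  with h(1) show ?thesis unfolding tensor_space_eq by blast
qed

lemma tensor_span:
  "linear_span (tensor_space U V) {tensor U V u v | u v. u \<in> carrier U \<and> v \<in> carrier V} =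
    carrier (tensor_space U V)"
proof -
  have "linear_span Q.Q
      ((\<lambda>p. tensor_relations U V +>\<^bsub>F\<^esub> p) ` (\<lambda>x. Poly_Mapping.single x 1) ` B) = carrier Q.Q"
    by (rule Q.quotient_span[OF _ free_space_span]) auto
  also have "(\<lambda>p. tensor_relations U V +>\<^bsub>F\<^esub> p) ` (\<lambda>x. Poly_Mapping.single x 1) ` B =
      {tensor U V u v | u v. u \<in> carrier U \<and> v \<in> carrier V}"
    by (auto simp: tensor_def)
  finally show ?thesis unfolding tensor_space_eq .
qed

end

section \<open>Direct sums\<close>

lemma direct_sum_simps [simp]:
  "carrier (direct_sum U V) = carrier U \<times> carrier V"
  "\<zero>\<^bsub>direct_sum U V\<^esub> = (\<zero>\<^bsub>U\<^esub>, \<zero>\<^bsub>V\<^esub>)"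
  "(u, v) \<oplus>\<^bsub>direct_sum U V\<^esub> (u', v') = (u \<oplus>\<^bsub>U\<^esub> u', v \<oplus>\<^bsub>V\<^esub> v')"
  "k \<odot>\<^bsub>direct_sum U V\<^esub> (u, v) = (k \<odot>\<^bsub>U\<^esub> u, k \<odot>\<^bsub>V\<^esub> v)"
  by (simp_all add: direct_sum_def)

lemma direct_sum_linear_space:
  fixes U :: "('k::field, 'a) module" and V :: "('k, 'b) module"
  assumes "linear_space U" "linear_space V"
  shows "linear_space (direct_sum U V)"
proof -
  interpret U: linear_space U by fact
  interpret V: linear_space V by fact
  have "abelian_group (direct_sum U V)"
  proof (rule abelian_groupI)
    show "\<exists>y \<in> carrier (direct_sum U V). y \<oplus>\<^bsub>direct_sum U V\<^esub> x = \<zero>\<^bsub>direct_sum U V\<^esub>"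
      if "x \<in> carrier (direct_sum U V)" for x
      using that by (intro bexI[of _ "(\<ominus>\<^bsub>U\<^esub> fst x, \<ominus>\<^bsub>V\<^esub> snd x)"]) (auto simp: U.l_neg V.l_neg)
  qed (auto simp: U.a_ac V.a_ac)
  then have "module scalars (direct_sum U V)"
    by (rule moduleI[OF cring_from_type_algebra])
      (auto simp: U.smult_add_left V.smult_add_left U.smult_add_right V.smult_add_right
        U.smult_mult V.smult_mult)
  then show ?thesis by (rule linear_space.intro)
qed

section \<open>Linear equations in abelian groups\<close>

context abelian_group
begin

text \<open>The library declares the \<open>algebra\<close> method only for rings.\<close>

lemmas abelian_group_simprules [algebra abelian_group "zero G" "add G" "a_inv G" "a_minus G"] =
  a_closed zero_closed a_inv_closed minus_closed a_assoc l_zero l_neg a_comm minus_eq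
  r_zero r_neg r_neg2 r_neg1 minus_add minus_minus add.inv_one a_lcomm

lemma add_eq_zero_iff: "a \<in> carrier G \<Longrightarrow> b \<in> carrier G \<Longrightarrow> a \<oplus> b = \<zero> \<longleftrightarrow> a = \<ominus> b"
  by (metis l_neg minus_equality minus_minus a_inv_closed)

lemma add_eq_iff_diff:
  "a \<in> carrier G \<Longrightarrow> b \<in> carrier G \<Longrightarrow> c \<in> carrier G \<Longrightarrow> a \<oplus> b = c \<longleftrightarrow> a = c \<oplus> \<ominus> b"
  by (metis a_assoc a_inv_closed l_neg r_neg r_zero)

text \<open>
  The system satisfied by \<open>p = x((bc)a)\<close>, \<open>q = x((ca)b)\<close>, \<open>r = x((ab)c)\<close> and the six terms \<open>P, \<dots>, U\<close>
  that arise from \<open>(bc)a\<close>, \<open>(ca)b\<close>, \<open>(ab)c\<close> by letting \<open>x\<close> act on one factor of the inner product.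
  All unknowns can be expressed by \<open>p\<close>, \<open>q\<close> and \<open>R\<close>.
\<close>

lemma antialgebra_linear_relations:
  assumes c: "p \<in> carrier G" "q \<in> carrier G" "r \<in> carrier G" "P \<in> carrier G" "Q \<in> carrier G"
      "R \<in> carrier G" "S \<in> carrier G" "T \<in> carrier G" "U \<in> carrier G"
    and e: "p \<oplus> q \<oplus> r = \<zero>" "P \<oplus> Q = p \<oplus> p" "S \<oplus> R = q \<oplus> q"
      "T \<oplus> (p \<oplus> S) = \<zero>" "U \<oplus> (P \<oplus> q) = \<zero>" "Q \<oplus> (R \<oplus> r) = \<zero>"
  shows "p \<ominus> S = P \<ominus> q" "Q \<ominus> R = (p \<ominus> q) \<oplus> (U \<ominus> T)"
proof -
  have 1: "r = \<ominus> (p \<oplus> q)"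
    using e(1) c by (metis a_closed add_eq_zero_iff a_comm)
  have 2: "Q = \<ominus> (R \<oplus> r)" using e(6) c by (simp add: add_eq_zero_iff)
  have 3: "P = p \<oplus> p \<oplus> \<ominus> Q" using e(2) c by (simp add: add_eq_iff_diff)
  have 4: "S = q \<oplus> q \<oplus> \<ominus> R" using e(3) c by (simp add: add_eq_iff_diff)
  have 5: "T = \<ominus> (p \<oplus> S)" using e(4) c by (simp add: add_eq_zero_iff)
  have 6: "U = \<ominus> (P \<oplus> q)" using e(5) c by (simp add: add_eq_zero_iff)
  show "p \<ominus> S = P \<ominus> q"
    unfolding 4 3 2 1 using c(1,2,6) by algebra
  show "Q \<ominus> R = (p \<ominus> q) \<oplus> (U \<ominus> T)"
    unfolding 5 6 4 3 2 1 using c(1,2,6) by algebra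
qed

end

section \<open>Identities in Lie antialgebras\<close>

text \<open>In characteristic 2 the scalar \<open>1 / 2\<close> of (LA1) has the junk value 0.\<close>

locale lie_antialgebra_char_neq_2 = lie_antialgebra V part mul
  for V :: "('k::field, 'v) module" (structure) and part and mul (infixl \<open>\<star>\<close> 75) +
  assumes two_neq_zero: "(2 :: 'k) \<noteq> 0"
begin

sublocale linear_space V by (rule linear_space.intro) (rule module_axioms)

lemma part_closed [simp]:
  "\<zero> \<in> part i"
  "v \<in> part 0 \<Longrightarrow> v \<in> carrier V"
  "v \<in> part 1 \<Longrightarrow> v \<in> carrier V"
  "v \<in> part i \<Longrightarrow> w \<in> part i \<Longrightarrow> v \<oplus> w \<in> part i"
  "v \<in> part i \<Longrightarrow> k \<odot> v \<in> part i"
  "v \<in> part i \<Longrightarrow> \<ominus> v \<in> part i"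
  "v \<in> part i \<Longrightarrow> w \<in> part i \<Longrightarrow> v \<ominus> w \<in> part i"
  using submoduleE(1)[OF part_submodule] submoduleE[OF part_submodule[of i]]
    subgroup.one_closed[OF submodule.axioms(1)[OF part_submodule[of i]]]
  by (auto simp: a_minus_def)

lemma part_mul [simp]:
  "x \<in> part 0 \<Longrightarrow> y \<in> part 0 \<Longrightarrow> x \<star> y \<in> part 0"
  "x \<in> part 0 \<Longrightarrow> a \<in> part 1 \<Longrightarrow> x \<star> a \<in> part 1"
  "a \<in> part 1 \<Longrightarrow> x \<in> part 0 \<Longrightarrow> a \<star> x \<in> part 1"
  "a \<in> part 1 \<Longrightarrow> b \<in> part 1 \<Longrightarrow> a \<star> b \<in> part 0"
  using mul_graded by fastforce+

lemma mul_closed [simp]: "v \<in> carrier V \<Longrightarrow> w \<in> carrier V \<Longrightarrow> v \<star> w \<in> carrier V"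
  using mul_bilinear unfolding bilinear_map_def by blast

lemma mul_left:
  "v \<in> carrier V \<Longrightarrow> w \<in> carrier V \<Longrightarrow> z \<in> carrier V \<Longrightarrow> (v \<oplus> w) \<star> z = v \<star> z \<oplus> w \<star> z"
  "v \<in> carrier V \<Longrightarrow> z \<in> carrier V \<Longrightarrow> (k \<odot> v) \<star> z = k \<odot> (v \<star> z)"
  "v \<in> carrier V \<Longrightarrow> z \<in> carrier V \<Longrightarrow> (\<ominus> v) \<star> z = \<ominus> (v \<star> z)"
  using linear_mapD[OF bilinear_map_left[OF mul_bilinear, of z]]
    linear_map_minus[OF linear_space_axioms linear_space_axioms
      bilinear_map_left[OF mul_bilinear, of z]]
  by auto

lemma mul_right:
  "v \<in> carrier V \<Longrightarrow> w \<in> carrier V \<Longrightarrow> z \<in> carrier V \<Longrightarrow> z \<star> (v \<oplus> w) = z \<star> v \<oplus> z \<star> w"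
  "v \<in> carrier V \<Longrightarrow> z \<in> carrier V \<Longrightarrow> z \<star> (k \<odot> v) = k \<odot> (z \<star> v)"
  "v \<in> carrier V \<Longrightarrow> z \<in> carrier V \<Longrightarrow> z \<star> (\<ominus> v) = \<ominus> (z \<star> v)"
  using linear_mapD[OF bilinear_map_right[OF mul_bilinear, of z]]
    linear_map_minus[OF linear_space_axioms linear_space_axioms
      bilinear_map_right[OF mul_bilinear, of z]]
  by auto

lemma odd_anticommute: "a \<in> part 1 \<Longrightarrow> b \<in> part 1 \<Longrightarrow> a \<star> b = \<ominus> (b \<star> a)"
  using supercommutative[of a 1 b 1] by (simp add: parity_sign_def smult_neg_one)

lemma even_commute: "x \<in> part 0 \<Longrightarrow> y \<in> part i \<Longrightarrow> y \<star> x = x \<star> y"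
  using supercommutative[of y i x 0] submoduleE(1)[OF part_submodule[of i]]
  by (auto simp: parity_sign_def)

text \<open>This is (LA1) with the denominator cleared, which needs 2 to be invertible. The double
  is written as a sum so that the linear system below lives in the additive group alone.\<close>

lemma even_mul_action:
  assumes "x \<in> part 0" "y \<in> part 0" "a \<in> part 1"
  shows "(x \<star> y) \<star> a = x \<star> (y \<star> a) \<oplus> x \<star> (y \<star> a)"
proof -
  have "2 \<odot> (x \<star> (y \<star> a)) = 2 \<odot> ((1 / 2) \<odot> (x \<star> y \<star> a))" using LA1[OF assms] by simp
  also have "\<dots> = (2 * (1 / 2)) \<odot> (x \<star> y \<star> a)" using assms by (subst smult_mult) auto
  also have "\<dots> = x \<star> y \<star> a" using assms two_neq_zero by simp
  finally show ?thesis using assms by (simp add: smult_two)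
qed

text \<open>By (LA1) the two sides are the halves of \<open>(x \<star> y) \<star> a\<close> and
  \<open>(y \<star> x) \<star> a\<close>, and even elements commute.\<close>

lemma even_action_commute:
  assumes "x \<in> part 0" "y \<in> part 0" "a \<in> part 1"
  shows "x \<star> (y \<star> a) = y \<star> (x \<star> a)"
  using LA1[OF assms] LA1[OF assms(2,1,3)] even_commute[OF assms(1,2)] by simp

text \<open>(LA3) in the normal form of the computations below, with the even factor of each term on
  the left.\<close>

lemma odd_cyclic:
  assumes "a \<in> part 1" "b \<in> part 1" "c \<in> part 1"
  shows "(b \<star> c) \<star> a \<oplus> (c \<star> a) \<star> b \<oplus> (a \<star> b) \<star> c = \<zero>"
  using LA3[OF assms] assms even_commute[of "b \<star> c" a 1] even_commute[of "c \<star> a" b 1]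
    even_commute[of "a \<star> b" c 1] by simp

text \<open>The even factors stand on the left; \<open>D_eq\<close> converts to the form in which
  the bracket is prescribed.\<close>

definition D :: "'v \<Rightarrow> 'v \<Rightarrow> 'v \<Rightarrow> 'v"
  where "D a b c = (b \<star> c) \<star> a \<oplus> (a \<star> c) \<star> b"

lemma D_odd [simp]: "a \<in> part 1 \<Longrightarrow> b \<in> part 1 \<Longrightarrow> c \<in> part 1 \<Longrightarrow> D a b c \<in> part 1"
  by (simp add: D_def)

lemma D_symmetric: "a \<in> part 1 \<Longrightarrow> b \<in> part 1 \<Longrightarrow> c \<in> part 1 \<Longrightarrow> D a b c = D b a c"
  by (simp add: D_def a_comm)

text \<open>Up to sign, every term of both identities is one of nine iterated products of
  \<open>x\<close>, \<open>a\<close>, \<open>b\<close>, \<open>c\<close>. The cyclic identity for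
  \<open>a, b, c\<close>, and for the triples where \<open>x\<close> has acted on one entry,
  together with (LA1) and (LA2), gives six linear relations among them, solved by
  \<open>antialgebra_linear_relations\<close>.\<close>

lemma
  assumes a: "a \<in> part 1" and b: "b \<in> part 1" and c: "c \<in> part 1" and x: "x \<in> part 0"
  shows D_balanced: "D (x \<star> a) b c = D a (x \<star> b) c"
    and D_even_action: "D a b (x \<star> c) = x \<star> D a b c \<oplus> (a \<star> (x \<star> b) \<oplus> b \<star> (x \<star> a)) \<star> c"
proof -
  note [simp] = a b c x
  let ?p = "x \<star> (b \<star> c \<star> a)" and ?q = "x \<star> (c \<star> a \<star> b)" and ?r = "x \<star> (a \<star> b \<star> c)"
  let ?P = "(x \<star> b) \<star> c \<star> a" and ?Q = "b \<star> (x \<star> c) \<star> a" and ?R = "(x \<star> c) \<star> a \<star> b"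
    and ?S = "c \<star> (x \<star> a) \<star> b" and ?T = "(x \<star> a) \<star> b \<star> c" and ?U = "a \<star> (x \<star> b) \<star> c"
  \<comment> \<open>The product \<open>(x \<star> (d \<star> e)) \<star> f\<close> is computed in
    two ways: (LA2) lets \<open>x\<close> act on \<open>d\<close> and \<open>e\<close> in turn,
    while (LA1) gives twice \<open>x \<star> (d \<star> e \<star> f)\<close>.\<close>
  have split: "(x \<star> d) \<star> e \<star> f \<oplus> d \<star> (x \<star> e) \<star> f = x \<star> (d \<star> e \<star> f) \<oplus> x \<star> (d \<star> e \<star> f)"
    if "d \<in> part 1" "e \<in> part 1" "f \<in> part 1" for d e f
  proof -
    have "(x \<star> d) \<star> e \<star> f \<oplus> d \<star> (x \<star> e) \<star> f = (x \<star> (d \<star> e)) \<star> f"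
      using that by (simp add: LA2 mul_left)
    then show ?thesis using that by (simp add: even_mul_action)
  qed
  have e: "?p \<oplus> ?q \<oplus> ?r = \<zero>" "?P \<oplus> ?Q = ?p \<oplus> ?p" "?S \<oplus> ?R = ?q \<oplus> ?q"
    "?T \<oplus> (?p \<oplus> ?S) = \<zero>" "?U \<oplus> (?P \<oplus> ?q) = \<zero>" "?Q \<oplus> (?R \<oplus> ?r) = \<zero>"
  proof -
    have "x \<star> (b \<star> c \<star> a \<oplus> c \<star> a \<star> b \<oplus> a \<star> b \<star> c) = x \<star> \<zero>"
      using odd_cyclic[of a b c] by simp
    moreover have "x \<star> \<zero> = \<zero>"
      using mul_right(2)[of \<zero> x 0] by simp
    ultimately show "?p \<oplus> ?q \<oplus> ?r = \<zero>" by (simp add: mul_right)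
    show "?P \<oplus> ?Q = ?p \<oplus> ?p" by (rule split) auto
    show "?S \<oplus> ?R = ?q \<oplus> ?q" using split[of c a b] by (simp add: a_comm)
    show "?T \<oplus> (?p \<oplus> ?S) = \<zero>"
      using odd_cyclic[of "x \<star> a" b c] even_action_commute[of x "b \<star> c" a] by (simp add: a_ac)
    show "?U \<oplus> (?P \<oplus> ?q) = \<zero>"
      using odd_cyclic[of a "x \<star> b" c] even_action_commute[of x "c \<star> a" b] by (simp add: a_ac)
    show "?Q \<oplus> (?R \<oplus> ?r) = \<zero>"
      using odd_cyclic[of a b "x \<star> c"] even_action_commute[of x "a \<star> b" c] by (simp add: a_ac)
  qed
  note K = antialgebra_linear_relations[OF _ _ _ _ _ _ _ _ _ e, simplified]
  \<comment> \<open>Exchanging the two inner odd factors costs a sign; this brings the terms of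
    \<open>D\<close> to the nine chosen products.\<close>
  have n: "d \<star> e \<star> f = \<ominus> (e \<star> d \<star> f)" if "d \<in> part 1" "e \<in> part 1" "f \<in> part 1" for d e f
    using that odd_anticommute[of d e] by (simp add: mul_left)
  have "D (x \<star> a) b c = ?p \<ominus> ?S"
    using n[of "x \<star> a" c b] even_action_commute[of x "b \<star> c" a] by (simp add: D_def a_minus_def)
  moreover have "D a (x \<star> b) c = ?P \<ominus> ?q"
    using even_action_commute[of x "c \<star> a" b] n[of a c "x \<star> b"] by (simp add: D_def a_minus_def)
  ultimately show "D (x \<star> a) b c = D a (x \<star> b) c" using K(1) by simp
  have "D a b (x \<star> c) = ?Q \<ominus> ?R"
    using n[of a "x \<star> c" b] by (simp add: D_def a_minus_def)
  moreover have "x \<star> D a b c = ?p \<ominus> ?q"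
    using n[of a c b] by (simp add: D_def a_minus_def mul_right)
  moreover have "(a \<star> (x \<star> b) \<oplus> b \<star> (x \<star> a)) \<star> c = ?U \<ominus> ?T"
    using n[of b "x \<star> a" c] by (simp add: a_minus_def mul_left)
  ultimately show "D a b (x \<star> c) = x \<star> D a b c \<oplus> (a \<star> (x \<star> b) \<oplus> b \<star> (x \<star> a)) \<star> c"
    using K(2) by simp
qed

text \<open>The cyclic identity solved for one of its terms; it exchanges the outer factor with an
  inner one.\<close>

lemma odd_cyclic_swap:
  assumes "b \<in> part 1" "d \<in> part 1" "e \<in> part 1"
  shows "(b \<star> e) \<star> d = (b \<star> d) \<star> e \<oplus> (d \<star> e) \<star> b"
proof -
  have "(e \<star> b) \<star> d = \<ominus> ((b \<star> e) \<star> d)"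
    using assms odd_anticommute[of e b] by (simp add: mul_left)
  then have "(d \<star> e) \<star> b \<oplus> \<ominus> ((b \<star> e) \<star> d) \<oplus> (b \<star> d) \<star> e = \<zero>"
    using odd_cyclic[OF assms] by simp
  then have "\<ominus> ((b \<star> e) \<star> d) \<oplus> ((b \<star> d) \<star> e \<oplus> (d \<star> e) \<star> b) = \<zero>"
    using assms by (simp add: a_ac)
  then show ?thesis using assms
    by (simp add: add_eq_zero_iff) (metis minus_minus mul_closed a_closed part_closed(3))
qed

text \<open>The left side is the multiplier of \<open>D_even_action\<close> for
  \<open>x = d \<star> e\<close>. The even products \<open>?X\<close> and \<open>?Y\<close> are each
  expanded by (LA2) in two ways, with either factor acting on the other. The four terms of the right
  side are thereby expressed through \<open>?X\<close>, \<open>?Y\<close> and the \<open>n\<close>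
  terms; \<open>?X\<close> and \<open>?Y\<close> cancel, and \<open>odd_cyclic_swap\<close>
  evaluates what is left.\<close>

lemma D_derivation:
  assumes "a \<in> part 1" "b \<in> part 1" "d \<in> part 1" "e \<in> part 1"
  shows "a \<star> (d \<star> e \<star> b) \<oplus> b \<star> (d \<star> e \<star> a) = D a b d \<star> e \<oplus> d \<star> D a b e"
proof -
  note [simp] = assms
  let ?X = "(b \<star> d) \<star> (a \<star> e)" and ?Y = "(a \<star> d) \<star> (b \<star> e)"
  let ?m1 = "(b \<star> d \<star> a) \<star> e" and ?n1 = "a \<star> (b \<star> d \<star> e)"
  let ?m2 = "(a \<star> d \<star> b) \<star> e" and ?n2 = "b \<star> (a \<star> d \<star> e)"
  let ?m3 = "d \<star> (b \<star> e \<star> a)" and ?n3 = "a \<star> (b \<star> e \<star> d)"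
  let ?m4 = "d \<star> (a \<star> e \<star> b)" and ?n4 = "b \<star> (a \<star> e \<star> d)"
  have 1: "?X = ?m1 \<oplus> ?n1" "?Y = ?m2 \<oplus> ?n2" by (simp_all add: LA2)
  \<comment> \<open>Here \<open>b \<star> e\<close> acts on \<open>d \<star> a\<close>, the other
    way of expanding the product; the signs come from exchanging odd factors.\<close>
  have 2: "\<ominus> ((a \<star> d) \<star> (b \<star> e)) = \<ominus> (a \<star> (b \<star> e \<star> d)) \<oplus> d \<star> (b \<star> e \<star> a)"
    if [simp]: "a \<in> part 1" "b \<in> part 1" for a b
  proof -
    have "\<ominus> ((a \<star> d) \<star> (b \<star> e)) = (b \<star> e) \<star> (d \<star> a)"
      using odd_anticommute[of d a] even_commute[of "a \<star> d" "b \<star> e" 0] by (simp add: mul_right)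
    also have "\<dots> = \<ominus> (a \<star> (b \<star> e \<star> d)) \<oplus> d \<star> (b \<star> e \<star> a)"
      using odd_anticommute[of "b \<star> e \<star> d" a] by (simp add: LA2)
    finally show ?thesis .
  qed
  have 3: "?n3 = ?n1 \<oplus> a \<star> (d \<star> e \<star> b)" "?n4 = ?n2 \<oplus> b \<star> (d \<star> e \<star> a)"
    using odd_cyclic_swap[of b d e] odd_cyclic_swap[of a d e] by (simp_all add: mul_right)
  have 4: "?m1 = ?X \<ominus> ?n1" "?m2 = ?Y \<ominus> ?n2"
    unfolding 1 by (simp_all add: a_minus_def a_assoc r_neg)
  have 5: "?m3 = ?n3 \<ominus> ?Y" "?m4 = ?n4 \<ominus> ?X"
    using 2[of a b] 2[of b a] by (simp_all add: a_minus_def a_assoc[symmetric] r_neg)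
  have "D a b d \<star> e \<oplus> d \<star> D a b e = ?m1 \<oplus> ?m2 \<oplus> (?m3 \<oplus> ?m4)"
    by (simp add: D_def mul_left mul_right)
  also have "\<dots> = (?X \<ominus> ?n1) \<oplus> (?Y \<ominus> ?n2) \<oplus>
      ((?n1 \<oplus> a \<star> (d \<star> e \<star> b) \<ominus> ?Y) \<oplus> (?n2 \<oplus> b \<star> (d \<star> e \<star> a) \<ominus> ?X))"
    by (simp only: 4 5 3)
  also have "\<dots> = a \<star> (d \<star> e \<star> b) \<oplus> b \<star> (d \<star> e \<star> a)"
  proof -
    have *: "(g \<ominus> n) \<oplus> (h \<ominus> m) \<oplus> ((n \<oplus> s \<ominus> h) \<oplus> (m \<oplus> t \<ominus> g)) = s \<oplus> t"
      if "g \<in> carrier V" "h \<in> carrier V" "n \<in> carrier V"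
        "m \<in> carrier V" "s \<in> carrier V" "t \<in> carrier V"
      for g h n m s t
      using that by algebra
    show ?thesis by (rule *) simp_all
  qed
  finally show ?thesis by simp
qed

text \<open>By \<open>D_even_action\<close> with \<open>x = d \<star> e\<close> and
  \<open>D_derivation\<close>, the operator \<open>D a b\<close> is a derivation of the triple
  product \<open>d \<star> e \<star> c\<close>. Since \<open>D c d e\<close> is a sum of two such
  products, the Leibniz rule carries over to it.\<close>

lemma D_commutator:
  assumes "a \<in> part 1" "b \<in> part 1" "c \<in> part 1" "d \<in> part 1" "e \<in> part 1"
  shows "D a b (D c d e) = D c d (D a b e) \<oplus> (D (D a b c) d e \<oplus> D c (D a b d) e)"
proof -
  note [simp] = assms
  have 1: "D a b (d \<star> e \<star> c) = d \<star> e \<star> D a b c \<oplus> (D a b d \<star> e \<star> c \<oplus> d \<star> D a b e \<star> c)"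
    if [simp]: "d \<in> part 1" "c \<in> part 1" for c d
    using D_even_action[of a b c "d \<star> e"] D_derivation[of a b d e] by (simp add: mul_left)
  have "D a b (D c d e) = D a b (d \<star> e \<star> c) \<oplus> D a b (c \<star> e \<star> d)"
    by (simp add: D_def mul_left mul_right a_ac)
  then show ?thesis
    unfolding 1[OF assms(4,3)] 1[OF assms(3,4)] by (simp add: D_def a_ac)
qed

subsection \<open>The even part of the Lie superalgebra\<close>

abbreviation "A1 \<equiv> odd_space V part"
abbreviation "T \<equiv> tensor_space A1 A1"
abbreviation "G0 \<equiv> ga_even V part (\<star>)"
abbreviation od (infixl \<open>\<diamondop>\<close> 70) where "a \<diamondop> b \<equiv> odot V part (\<star>) a b"

lemma odd_linear_space: "linear_space A1"
  by (rule linear_space.intro) (rule submodule.submodule_is_module[OF part_submodule module_axioms])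

sublocale A1: tensor_product A1 A1
  by (rule tensor_product.intro[OF odd_linear_space odd_linear_space])

sublocale T: linear_space T
  by (rule A1.tensor_linear_space)

abbreviation "tens \<equiv> tensor A1 A1"

lemma tens_closed: "a \<in> part 1 \<Longrightarrow> b \<in> part 1 \<Longrightarrow> tens a b \<in> carrier T"
  using A1.tensor_bilinear unfolding bilinear_map_def by simp

lemma ga_relations_gens:
  "{tens a b \<ominus>\<^bsub>T\<^esub> tens b a | a b. a \<in> part 1 \<and> b \<in> part 1} \<union>
   {tens (a \<star> x) b \<ominus>\<^bsub>T\<^esub> tens a (b \<star> x) | a b x. a \<in> part 1 \<and> b \<in> part 1 \<and> x \<in> part 0}
   \<subseteq> carrier T"
  by (auto simp: tens_closed)

sublocale S: quotient_by T "ga_relations V part (\<star>)"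
  unfolding ga_relations_def Let_def
  by (intro quotient_by.intro quotient_by_axioms.intro T.linear_space_axioms
      T.linear_span_submodule[OF ga_relations_gens])

lemma ga_even_eq: "G0 = S.Q"
  by (simp add: ga_even_def)

sublocale G0: linear_space G0
  unfolding ga_even_eq by (rule S.quotient_linear_space)

lemma odot_closed [simp]: "a \<in> part 1 \<Longrightarrow> b \<in> part 1 \<Longrightarrow> a \<diamondop> b \<in> carrier G0"
  using S.quotient_carrier tens_closed by (auto simp: odot_def ga_even_eq)

lemma odot_bilinear: "bilinear_map A1 A1 G0 (\<diamondop>)"
proof (intro bilinear_mapI linear_mapI)
  fix a b c k
  assume "a \<in> carrier A1" "b \<in> carrier A1"
  then have ab: "a \<in> part 1" "b \<in> part 1" by simp_all
  then show "a \<diamondop> b \<in> carrier G0" and "a \<diamondop> b \<in> carrier G0" by simp_all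
  note l = linear_mapD[OF bilinear_map_left[OF A1.tensor_bilinear]]
    and r = linear_mapD[OF bilinear_map_right[OF A1.tensor_bilinear]]
  show "(k \<odot>\<^bsub>A1\<^esub> a) \<diamondop> b = k \<odot>\<^bsub>G0\<^esub> (a \<diamondop> b)" "a \<diamondop> (k \<odot>\<^bsub>A1\<^esub> b) = k \<odot>\<^bsub>G0\<^esub> (a \<diamondop> b)"
    unfolding odot_def ga_even_eq S.coset_smult[OF tens_closed[OF ab]]
    using ab l(3)[of b a k] r(3)[of a b k] by simp_all
  assume "c \<in> carrier A1"
  then have c: "c \<in> part 1" by simp
  show "(a \<oplus>\<^bsub>A1\<^esub> c) \<diamondop> b = a \<diamondop> b \<oplus>\<^bsub>G0\<^esub> c \<diamondop> b"
    unfolding odot_def ga_even_eq S.coset_add[OF tens_closed[OF ab] tens_closed[OF c ab(2)]]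
    using ab c l(2)[of b a c] by simp
  show "a \<diamondop> (b \<oplus>\<^bsub>A1\<^esub> c) = a \<diamondop> b \<oplus>\<^bsub>G0\<^esub> a \<diamondop> c"
    unfolding odot_def ga_even_eq S.coset_add[OF tens_closed[OF ab] tens_closed[OF ab(1) c]]
    using ab c r(2)[of a b c] by simp
qed

lemma odot_linear:
  assumes "a \<in> part 1" "b \<in> part 1"
  shows odot_add_left: "c \<in> part 1 \<Longrightarrow> (a \<oplus> c) \<diamondop> b = a \<diamondop> b \<oplus>\<^bsub>G0\<^esub> c \<diamondop> b"
    and odot_add_right: "c \<in> part 1 \<Longrightarrow> a \<diamondop> (b \<oplus> c) = a \<diamondop> b \<oplus>\<^bsub>G0\<^esub> a \<diamondop> c"
    and odot_smult_left: "(k \<odot> a) \<diamondop> b = k \<odot>\<^bsub>G0\<^esub> (a \<diamondop> b)"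
    and odot_smult_right: "a \<diamondop> (k \<odot> b) = k \<odot>\<^bsub>G0\<^esub> (a \<diamondop> b)"
    and odot_minus_left: "(\<ominus> a) \<diamondop> b = \<ominus>\<^bsub>G0\<^esub> (a \<diamondop> b)"
    and odot_minus_right: "a \<diamondop> (\<ominus> b) = \<ominus>\<^bsub>G0\<^esub> (a \<diamondop> b)"
proof -
  note l = linear_mapD[OF bilinear_map_left[OF odot_bilinear]]
    and r = linear_mapD[OF bilinear_map_right[OF odot_bilinear]]
  show "c \<in> part 1 \<Longrightarrow> (a \<oplus> c) \<diamondop> b = a \<diamondop> b \<oplus>\<^bsub>G0\<^esub> c \<diamondop> b"
    "c \<in> part 1 \<Longrightarrow> a \<diamondop> (b \<oplus> c) = a \<diamondop> b \<oplus>\<^bsub>G0\<^esub> a \<diamondop> c"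
    "(k \<odot> a) \<diamondop> b = k \<odot>\<^bsub>G0\<^esub> (a \<diamondop> b)" "a \<diamondop> (k \<odot> b) = k \<odot>\<^bsub>G0\<^esub> (a \<diamondop> b)" for k
    using assms l(2)[of b a c] l(3)[of b a k] r(2)[of a b c] r(3)[of a b k] by simp_all
  from this(3,4)[of "- 1"] assms
  show "(\<ominus> a) \<diamondop> b = \<ominus>\<^bsub>G0\<^esub> (a \<diamondop> b)" "a \<diamondop> (\<ominus> b) = \<ominus>\<^bsub>G0\<^esub> (a \<diamondop> b)"
    by (simp_all add: smult_neg_one G0.smult_neg_one)
qed

lemma odot_commute:
  assumes "a \<in> part 1" "b \<in> part 1"
  shows "a \<diamondop> b = b \<diamondop> a"
  unfolding odot_def
proof (subst S.coset_eq_iff)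
  show "tens a b \<ominus>\<^bsub>T\<^esub> tens b a \<in> ga_relations V part (\<star>)"
    unfolding ga_relations_def Let_def linear_span_def using assms by (intro hull_inc) blast
qed (use assms tens_closed in auto)

text \<open>The defining relation multiplies by \<open>x\<close> on the right; as even and odd
  elements commute, it can be read as a left action.\<close>

lemma odot_balanced:
  assumes "a \<in> part 1" "b \<in> part 1" "x \<in> part 0"
  shows "(x \<star> a) \<diamondop> b = a \<diamondop> (x \<star> b)"
proof -
  have "(a \<star> x) \<diamondop> b = a \<diamondop> (b \<star> x)"
    unfolding odot_def
  proof (subst S.coset_eq_iff)
    show "tens (a \<star> x) b \<ominus>\<^bsub>T\<^esub> tens a (b \<star> x) \<in> ga_relations V part (\<star>)"
      unfolding ga_relations_def Let_def linear_span_def using assms by (intro hull_inc) blast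
  qed (use assms tens_closed in auto)
  then show ?thesis using assms even_commute[of x _ 1] by simp
qed

text \<open>Bilinearity factors \<open>f\<close> through the tensor product; symmetry and balance
  make the factored map vanish on the two families of generators of
  \<open>ga_relations\<close>.\<close>

lemma odot_lift:
  assumes W: "linear_space W" and f: "bilinear_map A1 A1 W f"
    and sym: "\<And>a b. a \<in> part 1 \<Longrightarrow> b \<in> part 1 \<Longrightarrow> f a b = f b a"
    and bal: "\<And>a b x. a \<in> part 1 \<Longrightarrow> b \<in> part 1 \<Longrightarrow> x \<in> part 0 \<Longrightarrow> f (x \<star> a) b = f a (x \<star> b)"
  shows "\<exists>g. linear_map G0 W g \<and> (\<forall>a \<in> part 1. \<forall>b \<in> part 1. g (a \<diamondop> b) = f a b)"
proof -
  interpret W: linear_space W by fact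
  have fc: "f a b \<in> carrier W" if "a \<in> part 1" "b \<in> part 1" for a b
    using f that unfolding bilinear_map_def by simp
  obtain g where g: "linear_map T W g" "\<And>a b. a \<in> part 1 \<Longrightarrow> b \<in> part 1 \<Longrightarrow> g (tens a b) = f a b"
    using A1.tensor_lift[OF W f] by auto
  have d: "g (tens a b \<ominus>\<^bsub>T\<^esub> tens c d) = f a b \<ominus>\<^bsub>W\<^esub> f c d"
    if "a \<in> part 1" "b \<in> part 1" "c \<in> part 1" "d \<in> part 1" for a b c d
    using that linear_map_add[OF g(1)] linear_map_minus[OF T.linear_space_axioms W g(1)]
      g(2) tens_closed
    by (simp add: a_minus_def)
  have z: "w \<ominus>\<^bsub>W\<^esub> w = \<zero>\<^bsub>W\<^esub>" if "w \<in> carrier W" for w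
    using that by (simp add: a_minus_def W.r_neg)
  have "g p = \<zero>\<^bsub>W\<^esub>" if p: "p \<in> ga_relations V part (\<star>)" for p
  proof (rule linear_map_eq_on_span[OF T.linear_space_axioms W g(1) linear_map_const_zero[OF W]
      ga_relations_gens _ p[unfolded ga_relations_def Let_def]])
    fix u
    assume "u \<in> {tens a b \<ominus>\<^bsub>T\<^esub> tens b a | a b. a \<in> part 1 \<and> b \<in> part 1} \<union>
      {tens (a \<star> x) b \<ominus>\<^bsub>T\<^esub> tens a (b \<star> x) | a b x. a \<in> part 1 \<and> b \<in> part 1 \<and> x \<in> part 0}"
    then show "g u = \<zero>\<^bsub>W\<^esub>"
    proof (elim UnE CollectE exE conjE)
      show "g u = \<zero>\<^bsub>W\<^esub>" if "u = tens a b \<ominus>\<^bsub>T\<^esub> tens b a" "a \<in> part 1" "b \<in> part 1" for a b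
        using that sym[of a b] fc[of b a] by (simp add: d z)
      show "g u = \<zero>\<^bsub>W\<^esub>"
        if "u = tens (a \<star> x) b \<ominus>\<^bsub>T\<^esub> tens a (b \<star> x)" "a \<in> part 1" "b \<in> part 1" "x \<in> part 0" for a b x
        using that bal[of a b x] fc[of a "x \<star> b"] even_commute[of x _ 1]
        by (simp add: d z)
    qed
  qed
  from S.quotient_lift[OF W g(1) this] obtain h where h: "linear_map S.Q W h"
    "\<And>p. p \<in> carrier T \<Longrightarrow> h (ga_relations V part (\<star>) +>\<^bsub>T\<^esub> p) = g p"
    by blast
  then have "\<forall>a \<in> part 1. \<forall>b \<in> part 1. h (a \<diamondop> b) = f a b"
    using g(2) tens_closed by (simp add: odot_def)
  with h(1) show ?thesis unfolding ga_even_eq by blast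
qed

lemma odot_span: "linear_span G0 {a \<diamondop> b | a b. a \<in> part 1 \<and> b \<in> part 1} = carrier G0"
proof -
  have "linear_span S.Q ((\<lambda>p. ga_relations V part (\<star>) +>\<^bsub>T\<^esub> p) `
      {tens a b | a b. a \<in> carrier A1 \<and> b \<in> carrier A1}) = carrier S.Q"
    by (rule S.quotient_span[OF _ A1.tensor_span]) (auto simp: tens_closed)
  also have "(\<lambda>p. ga_relations V part (\<star>) +>\<^bsub>T\<^esub> p) `
      {tens a b | a b. a \<in> carrier A1 \<and> b \<in> carrier A1} =
      {a \<diamondop> b | a b. a \<in> part 1 \<and> b \<in> part 1}"
    by (auto simp: odot_def)
  finally show ?thesis unfolding ga_even_eq .
qed

text \<open>The elements with property \<open>P\<close> form a submodule that contains the
  generators, hence the whole space by \<open>odot_span\<close>.\<close>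

lemma ga_even_induct [consumes 1, case_names odot add smult]:
  assumes "u \<in> carrier G0"
    and od: "\<And>a b. a \<in> part 1 \<Longrightarrow> b \<in> part 1 \<Longrightarrow> P (a \<diamondop> b)"
    and add: "\<And>u v. u \<in> carrier G0 \<Longrightarrow> v \<in> carrier G0 \<Longrightarrow> P u \<Longrightarrow> P v \<Longrightarrow> P (u \<oplus>\<^bsub>G0\<^esub> v)"
    and smult: "\<And>k u. u \<in> carrier G0 \<Longrightarrow> P u \<Longrightarrow> P (k \<odot>\<^bsub>G0\<^esub> u)"
  shows "P u"
proof -
  \<comment> \<open>Zero is reached as the zero multiple of a generator, so the rule needs no
    separate case for it.\<close>
  have "P \<zero>\<^bsub>G0\<^esub>" using smult[of "\<zero> \<diamondop> \<zero>" 0] od[of \<zero> \<zero>] by simp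
  then have "submodule {u \<in> carrier G0. P u} scalars G0"
    using add smult by (intro G0.submodule_scalarsI) auto
  moreover have "{a \<diamondop> b | a b. a \<in> part 1 \<and> b \<in> part 1} \<subseteq> {u \<in> carrier G0. P u}"
    using od by auto
  ultimately have "linear_span G0 {a \<diamondop> b | a b. a \<in> part 1 \<and> b \<in> part 1} \<subseteq> {u \<in> carrier G0. P u}"
    unfolding linear_span_def by (intro hull_minimal)
  then show ?thesis using assms(1) odot_span by blast
qed

subsection \<open>The action on odd elements and the bracket\<close>

lemma D_linear:
  assumes "a \<in> part 1" "b \<in> part 1" "c \<in> part 1"
  shows "a' \<in> part 1 \<Longrightarrow> D (a \<oplus> a') b c = D a b c \<oplus> D a' b c" "D (k \<odot> a) b c = k \<odot> D a b c"
    "b' \<in> part 1 \<Longrightarrow> D a (b \<oplus> b') c = D a b c \<oplus> D a b' c" "D a (k \<odot> b) c = k \<odot> D a b c"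
    "c' \<in> part 1 \<Longrightarrow> D a b (c \<oplus> c') = D a b c \<oplus> D a b c'" "D a b (k \<odot> c) = k \<odot> D a b c"
  using assms by (simp_all add: D_def mul_left mul_right smult_add_right a_ac)

lemma action_exists:
  assumes "c \<in> part 1"
  shows "\<exists>g. linear_map G0 A1 g \<and> (\<forall>a \<in> part 1. \<forall>b \<in> part 1. g (a \<diamondop> b) = D a b c)"
proof (rule odot_lift[OF odd_linear_space])
  show "bilinear_map A1 A1 A1 (\<lambda>a b. D a b c)"
    by (intro bilinear_mapI linear_mapI) (use assms in \<open>simp_all add: D_linear\<close>)
qed (use assms D_symmetric D_balanced in auto)

text \<open>A linear map in \<open>u\<close> is chosen separately for each \<open>c\<close>:
  linearity in \<open>u\<close> is built in, while linearity in \<open>c\<close> has to be proved in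
  \<open>action_right\<close> by induction on \<open>u\<close>. On the carriers the choice is forced
  because the generators span.\<close>

definition action :: "('v \<times> 'v \<Rightarrow>\<^sub>0 'k) set set \<Rightarrow> 'v \<Rightarrow> 'v"
  where "action u c = (SOME g. linear_map G0 A1 g \<and>
    (\<forall>a \<in> part 1. \<forall>b \<in> part 1. g (a \<diamondop> b) = D a b c)) u"

lemma
  assumes "c \<in> part 1"
  shows action_linear_map: "linear_map G0 A1 (\<lambda>u. action u c)"
    and action_odot: "a \<in> part 1 \<Longrightarrow> b \<in> part 1 \<Longrightarrow> action (a \<diamondop> b) c = D a b c"
  using someI_ex[OF action_exists[OF assms]] unfolding action_def by blast+

lemma action_odd [simp]: "u \<in> carrier G0 \<Longrightarrow> c \<in> part 1 \<Longrightarrow> action u c \<in> part 1"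
  using linear_map_closed[OF action_linear_map] by simp

lemma action_left:
  assumes "c \<in> part 1" "u \<in> carrier G0"
  shows "v \<in> carrier G0 \<Longrightarrow> action (u \<oplus>\<^bsub>G0\<^esub> v) c = action u c \<oplus> action v c"
    and "action (k \<odot>\<^bsub>G0\<^esub> u) c = k \<odot> action u c"
  using linear_mapD[OF action_linear_map[OF assms(1)]] assms(2) by simp_all

lemma action_right:
  assumes "u \<in> carrier G0" "c \<in> part 1"
  shows "d \<in> part 1 \<Longrightarrow> action u (c \<oplus> d) = action u c \<oplus> action u d"
    and "action u (k \<odot> c) = k \<odot> action u c"
proof -
  show "action u (c \<oplus> d) = action u c \<oplus> action u d" if "d \<in> part 1"
    using assms(1)
  proof (induction rule: ga_even_induct)
    case (odot a b)
    then show ?case using assms(2) that by (simp add: action_odot D_linear)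
  next
    case (add u v)
    then show ?case using assms(2) that by (simp add: action_left a_ac)
  next
    case (smult k u)
    then show ?case using assms(2) that by (simp add: action_left smult_add_right)
  qed
  show "action u (k \<odot> c) = k \<odot> action u c"
    using assms(1)
  proof (induction rule: ga_even_induct)
    case (odot a b)
    then show ?case using assms(2) by (simp add: action_odot D_linear)
  next
    case (add u v)
    then show ?case using assms(2) by (simp add: action_left smult_add_right)
  next
    case (smult l u)
    then show ?case using assms(2) by (simp add: action_left smult_mult[symmetric] mult.commute)
  qed
qed

text \<open>This is the balance condition needed for the Leibniz extension. For
  \<open>u = a \<diamondop> b\<close>, \<open>D_even_action\<close> produces terms with the even
  multipliers \<open>x\<close> and
  \<open>a \<star> (x \<star> b) \<oplus> b \<star> (x \<star> a)\<close>; each multiplier can be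
  moved across \<open>\<diamondop>\<close> by \<open>odot_balanced\<close>, which matches the two
  sides.\<close>

lemma action_balanced:
  assumes "u \<in> carrier G0" "c \<in> part 1" "d \<in> part 1" "x \<in> part 0"
  shows "action u (x \<star> c) \<diamondop> d \<oplus>\<^bsub>G0\<^esub> (x \<star> c) \<diamondop> action u d =
    action u c \<diamondop> (x \<star> d) \<oplus>\<^bsub>G0\<^esub> c \<diamondop> action u (x \<star> d)"
  using assms(1)
proof (induction rule: ga_even_induct)
  case (odot a b)
  then show ?case
    using assms(2-4)
    by (simp add: action_odot D_even_action odot_linear odot_balanced G0.a_ac)
next
  case (add u v)
  let ?f = "\<lambda>u. action u (x \<star> c) \<diamondop> d" and ?g = "\<lambda>u. (x \<star> c) \<diamondop> action u d"
    and ?h = "\<lambda>u. action u c \<diamondop> (x \<star> d)" and ?i = "\<lambda>u. c \<diamondop> action u (x \<star> d)"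
  have "(?f u \<oplus>\<^bsub>G0\<^esub> ?g u) \<oplus>\<^bsub>G0\<^esub> (?f v \<oplus>\<^bsub>G0\<^esub> ?g v) = (?h u \<oplus>\<^bsub>G0\<^esub> ?i u) \<oplus>\<^bsub>G0\<^esub> (?h v \<oplus>\<^bsub>G0\<^esub> ?i v)"
    using add by simp
  then show ?case
    using add(1,2) assms(2-4) by (simp add: action_left odot_linear G0.a_ac)
next
  case (smult k u)
  then show ?case
    using assms(2-4) by (simp add: action_left odot_linear G0.smult_add_right[symmetric])
qed

section \<open>Extension of the action to the even part by the Leibniz rule\<close>

lemma derivation_exists:
  assumes "u \<in> carrier G0"
  shows "\<exists>g. linear_map G0 G0 g \<and>
    (\<forall>c \<in> part 1. \<forall>d \<in> part 1. g (c \<diamondop> d) = action u c \<diamondop> d \<oplus>\<^bsub>G0\<^esub> c \<diamondop> action u d)"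
proof (rule odot_lift[OF G0.linear_space_axioms])
  show "bilinear_map A1 A1 G0 (\<lambda>c d. action u c \<diamondop> d \<oplus>\<^bsub>G0\<^esub> c \<diamondop> action u d)"
    by (intro bilinear_mapI linear_mapI)
      (use assms in \<open>simp_all add: action_right odot_linear G0.smult_add_right G0.a_ac\<close>)
  show "action u c \<diamondop> d \<oplus>\<^bsub>G0\<^esub> c \<diamondop> action u d = action u d \<diamondop> c \<oplus>\<^bsub>G0\<^esub> d \<diamondop> action u c"
    if "c \<in> part 1" "d \<in> part 1" for c d
    using that assms odot_commute[of "action u c" d] odot_commute[of c "action u d"]
    by (simp add: G0.a_comm)
qed (use assms action_balanced in auto)

text \<open>The bracket of two even elements, introduced by the Leibniz rule rather than by the
  prescribed formula: this makes linearity in the second argument immediate and prepares the Jacobi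
  identity. \<open>der_odot_odot\<close> recovers the formula.\<close>

definition der :: "('v \<times> 'v \<Rightarrow>\<^sub>0 'k) set set \<Rightarrow> ('v \<times> 'v \<Rightarrow>\<^sub>0 'k) set set \<Rightarrow> ('v \<times> 'v \<Rightarrow>\<^sub>0 'k) set set"
  where "der u = (SOME g. linear_map G0 G0 g \<and>
    (\<forall>c \<in> part 1. \<forall>d \<in> part 1. g (c \<diamondop> d) = action u c \<diamondop> d \<oplus>\<^bsub>G0\<^esub> c \<diamondop> action u d))"

lemma
  assumes "u \<in> carrier G0"
  shows der_linear_map: "linear_map G0 G0 (der u)"
    and der_odot: "c \<in> part 1 \<Longrightarrow> d \<in> part 1 \<Longrightarrow>
      der u (c \<diamondop> d) = action u c \<diamondop> d \<oplus>\<^bsub>G0\<^esub> c \<diamondop> action u d"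
  using someI_ex[OF derivation_exists[OF assms]] unfolding der_def by blast+

lemma der_closed [simp]: "u \<in> carrier G0 \<Longrightarrow> v \<in> carrier G0 \<Longrightarrow> der u v \<in> carrier G0"
  using linear_map_closed[OF der_linear_map] by simp

lemma der_right:
  assumes "u \<in> carrier G0" "v \<in> carrier G0"
  shows "w \<in> carrier G0 \<Longrightarrow> der u (v \<oplus>\<^bsub>G0\<^esub> w) = der u v \<oplus>\<^bsub>G0\<^esub> der u w"
    and "der u (k \<odot>\<^bsub>G0\<^esub> v) = k \<odot>\<^bsub>G0\<^esub> der u v"
  using linear_mapD[OF der_linear_map[OF assms(1)]] assms(2) by simp_all

lemma der_left:
  assumes "v \<in> carrier G0" "u \<in> carrier G0"
  shows "w \<in> carrier G0 \<Longrightarrow> der (u \<oplus>\<^bsub>G0\<^esub> w) v = der u v \<oplus>\<^bsub>G0\<^esub> der w v"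
    and "der (k \<odot>\<^bsub>G0\<^esub> u) v = k \<odot>\<^bsub>G0\<^esub> der u v"
proof -
  show "der (u \<oplus>\<^bsub>G0\<^esub> w) v = der u v \<oplus>\<^bsub>G0\<^esub> der w v" if "w \<in> carrier G0"
    using assms(1)
  proof (induction rule: ga_even_induct)
    case (odot a b)
    then show ?case using assms(2) that by (simp add: der_odot action_left odot_linear G0.a_ac)
  next
    case (add v v')
    then show ?case using assms(2) that by (simp add: der_right G0.a_ac)
  next
    case (smult k v)
    then show ?case using assms(2) that by (simp add: der_right G0.smult_add_right)
  qed
  show "der (k \<odot>\<^bsub>G0\<^esub> u) v = k \<odot>\<^bsub>G0\<^esub> der u v"
    using assms(1)
  proof (induction rule: ga_even_induct)
    case (odot a b)
    then show ?case using assms(2)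
      by (simp add: der_odot action_left odot_linear G0.smult_add_right)
  next
    case (add v v')
    then show ?case using assms(2) by (simp add: der_right G0.smult_add_right)
  next
    case (smult l v)
    then show ?case using assms(2) by (simp add: der_right G0.smult_mult[symmetric] mult.commute)
  qed
qed

text \<open>The Leibniz rule gives four terms. The cyclic identity and balance rewrite
  \<open>c \<diamondop> (b \<star> d \<star> a)\<close> as
  \<open>?\<epsilon> \<oplus> ?\<alpha>\<close>, and likewise
  \<open>c \<diamondop> (a \<star> d \<star> b)\<close> as
  \<open>?\<epsilon> \<oplus> ?\<beta>\<close>, because \<open>?\<epsilon>\<close> is symmetric in
  \<open>a\<close> and \<open>b\<close>.\<close>

lemma der_odot_odot:
  assumes "a \<in> part 1" "b \<in> part 1" "c \<in> part 1" "d \<in> part 1"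
  shows "der (a \<diamondop> b) (c \<diamondop> d) =
    2 \<odot>\<^bsub>G0\<^esub> ((b \<star> c \<star> a) \<diamondop> d) \<oplus>\<^bsub>G0\<^esub> 2 \<odot>\<^bsub>G0\<^esub> ((a \<star> d \<star> b) \<diamondop> c)"
proof -
  note [simp] = assms
  let ?\<alpha> = "(b \<star> c \<star> a) \<diamondop> d" and ?\<beta> = "(a \<star> c \<star> b) \<diamondop> d" and ?\<epsilon> = "(c \<star> d \<star> a) \<diamondop> b"
  have 1: "c \<diamondop> (b \<star> d \<star> a) = (c \<star> d \<star> a) \<diamondop> b \<oplus>\<^bsub>G0\<^esub> (b \<star> c \<star> a) \<diamondop> d"
    if [simp]: "a \<in> part 1" "b \<in> part 1" for a b
  proof -
    have "c \<diamondop> (b \<star> d \<star> a) = a \<diamondop> (b \<star> d \<star> c)"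
      using odot_commute[of c "b \<star> d \<star> a"] odot_balanced[of a c "b \<star> d"] by simp
    also have "\<dots> = a \<diamondop> (c \<star> d \<star> b) \<oplus>\<^bsub>G0\<^esub> a \<diamondop> (b \<star> c \<star> d)"
      using odd_cyclic_swap[of b c d] by (simp add: odot_linear G0.a_comm)
    finally show ?thesis
      using odot_balanced[of a b "c \<star> d"] odot_balanced[of a d "b \<star> c"] by simp
  qed
  have 2: "(c \<star> d \<star> b) \<diamondop> a = ?\<epsilon>"
    using odot_balanced[of b a "c \<star> d"] odot_commute[of b "c \<star> d \<star> a"] by simp
  have "der (a \<diamondop> b) (c \<diamondop> d) =
      ?\<alpha> \<oplus>\<^bsub>G0\<^esub> ?\<beta> \<oplus>\<^bsub>G0\<^esub> (c \<diamondop> (b \<star> d \<star> a) \<oplus>\<^bsub>G0\<^esub> c \<diamondop> (a \<star> d \<star> b))"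
    by (simp add: der_odot action_odot D_def odot_linear)
  \<comment> \<open>The remaining \<open>?\<beta>\<close> and \<open>?\<epsilon>\<close> combine to
    a second copy of \<open>c \<diamondop> (a \<star> d \<star> b)\<close>.\<close>
  also have "\<dots> = 2 \<odot>\<^bsub>G0\<^esub> ?\<alpha> \<oplus>\<^bsub>G0\<^esub> 2 \<odot>\<^bsub>G0\<^esub> (c \<diamondop> (a \<star> d \<star> b))"
    unfolding 1[OF assms(1,2)] 1[OF assms(2,1)] 2 by (simp add: G0.smult_two G0.a_ac)
  finally show ?thesis using odot_commute[of c "a \<star> d \<star> b"] by simp
qed

text \<open>The Leibniz rule treats the arguments differently, so the symmetric formula of
  \<open>der_odot_odot\<close> is used on generators: exchanging the pairs \<open>a, b\<close> and
  \<open>c, d\<close> interchanges its two terms with a sign.\<close>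

lemma der_antisymmetric:
  assumes "u \<in> carrier G0" "v \<in> carrier G0"
  shows "der u v = \<ominus>\<^bsub>G0\<^esub> der v u"
  using assms
proof (induction u rule: ga_even_induct)
  case (odot a b)
  note ab = odot(1,2)
  from odot(3) show ?case
  proof (induction v rule: ga_even_induct)
    case (odot c d)
    have 1: "(d \<star> a \<star> c) \<diamondop> b = \<ominus>\<^bsub>G0\<^esub> ((a \<star> d \<star> b) \<diamondop> c)"
      if "a \<in> part 1" "b \<in> part 1" "c \<in> part 1" "d \<in> part 1" for a b c d
      using that odd_anticommute[of d a] odot_balanced[of c b "a \<star> d"]
        odot_commute[of c "a \<star> d \<star> b"]
      by (simp add: mul_left odot_linear)
    show ?case
      using ab odot
      by (simp add: der_odot_odot 1[of a b c d] 1[of b a d c] G0.smult_neg G0.minus_add G0.a_comm)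
  qed (use ab in \<open>simp_all add: der_left der_right G0.minus_add G0.smult_neg\<close>)
qed (simp_all add: der_left der_right G0.minus_add G0.smult_neg)

text \<open>Bilinear extension of \<open>D_commutator\<close>: the action is a representation of the
  even part on the odd part.\<close>

lemma action_der:
  assumes "u \<in> carrier G0" "v \<in> carrier G0" "e \<in> part 1"
  shows "action u (action v e) = action v (action u e) \<oplus> action (der u v) e"
  using assms(1,2)
proof (induction u rule: ga_even_induct)
  case (odot a b)
  note ab = odot(1,2)
  from odot(3) show ?case
  proof (induction v rule: ga_even_induct)
    case (odot c d)
    then show ?case
      using ab assms(3) D_commutator[of a b c d e] by (simp add: action_odot der_odot action_left)
  qed (use ab assms(3) in \<open>simp_all add: action_left action_right der_right smult_add_right a_ac\<close>)
qed (use assms(3) in \<open>simp_all add: action_left action_right der_left smult_add_right a_ac\<close>)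

text \<open>On a generator \<open>c \<diamondop> d\<close> the mixed terms, with one operator on
  each factor, are symmetric in \<open>u\<close> and \<open>v\<close>; the other terms are governed
  by \<open>action_der\<close>.\<close>

lemma der_der:
  assumes "u \<in> carrier G0" "v \<in> carrier G0" "w \<in> carrier G0"
  shows "der u (der v w) = der v (der u w) \<oplus>\<^bsub>G0\<^esub> der (der u v) w"
  using assms(3)
proof (induction w rule: ga_even_induct)
  case (odot c d)
  then show ?case
    using assms action_der[of u v c] action_der[of u v d]
    by (simp add: der_odot der_right odot_linear G0.a_ac)
qed (use assms in \<open>simp_all add: der_right G0.smult_add_right G0.a_ac\<close>)

lemma zero_simps [simp]:
  "c \<in> part 1 \<Longrightarrow> action \<zero>\<^bsub>G0\<^esub> c = \<zero>"
  "u \<in> carrier G0 \<Longrightarrow> action u \<zero> = \<zero>"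
  "u \<in> carrier G0 \<Longrightarrow> der \<zero>\<^bsub>G0\<^esub> u = \<zero>\<^bsub>G0\<^esub>"
  "u \<in> carrier G0 \<Longrightarrow> der u \<zero>\<^bsub>G0\<^esub> = \<zero>\<^bsub>G0\<^esub>"
  "c \<in> part 1 \<Longrightarrow> c \<diamondop> \<zero> = \<zero>\<^bsub>G0\<^esub>"
  "c \<in> part 1 \<Longrightarrow> \<zero> \<diamondop> c = \<zero>\<^bsub>G0\<^esub>"
  using action_left(2)[of c "\<zero>\<^bsub>G0\<^esub>" 0] action_right(2)[of u \<zero> 0] der_left(2)[of u "\<zero>\<^bsub>G0\<^esub>" 0]
    der_right(2)[of u "\<zero>\<^bsub>G0\<^esub>" 0] odot_smult_right[of c \<zero> 0] odot_smult_left[of \<zero> c 0]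
  by simp_all

lemma neg_simps:
  "c \<in> part 1 \<Longrightarrow> u \<in> carrier G0 \<Longrightarrow> action u (\<ominus> c) = \<ominus> action u c"
  "u \<in> carrier G0 \<Longrightarrow> v \<in> carrier G0 \<Longrightarrow> der u (\<ominus>\<^bsub>G0\<^esub> v) = \<ominus>\<^bsub>G0\<^esub> der u v"
  using action_right(2)[of u c "- 1"] der_right(2)[of u v "- 1"]
  by (simp_all add: smult_neg_one G0.smult_neg_one)

section \<open>The bracket on the whole graded space, with its uniqueness\<close>

abbreviation "G \<equiv> ga V part (\<star>)"

lemma ga_simps [simp]:
  "carrier G = carrier G0 \<times> part 1"
  "\<zero>\<^bsub>G\<^esub> = (\<zero>\<^bsub>G0\<^esub>, \<zero>)"
  "(u, v) \<oplus>\<^bsub>G\<^esub> (u', v') = (u \<oplus>\<^bsub>G0\<^esub> u', v \<oplus> v')"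
  "k \<odot>\<^bsub>G\<^esub> (u, v) = (k \<odot>\<^bsub>G0\<^esub> u, k \<odot> v)"
  by (simp_all add: ga_def)

sublocale G: linear_space G
  unfolding ga_def by (rule direct_sum_linear_space[OF G0.linear_space_axioms odd_linear_space])

lemma ga_induct [consumes 1, case_names even odd add smult]:
  assumes "x \<in> carrier G"
    and even: "\<And>a b. a \<in> part 1 \<Longrightarrow> b \<in> part 1 \<Longrightarrow> P (a \<diamondop> b, \<zero>)"
    and odd: "\<And>a. a \<in> part 1 \<Longrightarrow> P (\<zero>\<^bsub>G0\<^esub>, a)"
    and add: "\<And>x y. x \<in> carrier G \<Longrightarrow> y \<in> carrier G \<Longrightarrow> P x \<Longrightarrow> P y \<Longrightarrow> P (x \<oplus>\<^bsub>G\<^esub> y)"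
    and smult: "\<And>k x. x \<in> carrier G \<Longrightarrow> P x \<Longrightarrow> P (k \<odot>\<^bsub>G\<^esub> x)"
  shows "P x"
proof -
  obtain u c where x: "x = (u, c)" "u \<in> carrier G0" "c \<in> part 1" using assms(1) by auto
  have "P (u, \<zero>)"
    using x(2)
  proof (induction rule: ga_even_induct)
    case (odot a b)
    then show ?case by (rule even)
  next
    case (add u v)
    then show ?case using assms(4)[of "(u, \<zero>)" "(v, \<zero>)"] by simp
  next
    case (smult k u)
    then show ?case using assms(5)[of "(u, \<zero>)" k] by simp
  qed
  then show ?thesis using add[of "(u, \<zero>)" "(\<zero>\<^bsub>G0\<^esub>, c)"] odd[of c] x by simp
qed

definition bracket where
  "bracket x y = (der (fst x) (fst y) \<oplus>\<^bsub>G0\<^esub> snd x \<diamondop> snd y,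
    action (fst x) (snd y) \<ominus> action (fst y) (snd x))"

lemma bracket_homogeneous [simp]:
  "u \<in> carrier G0 \<Longrightarrow> v \<in> carrier G0 \<Longrightarrow> bracket (u, \<zero>) (v, \<zero>) = (der u v, \<zero>)"
  "u \<in> carrier G0 \<Longrightarrow> c \<in> part 1 \<Longrightarrow> bracket (u, \<zero>) (\<zero>\<^bsub>G0\<^esub>, c) = (\<zero>\<^bsub>G0\<^esub>, action u c)"
  "u \<in> carrier G0 \<Longrightarrow> c \<in> part 1 \<Longrightarrow> bracket (\<zero>\<^bsub>G0\<^esub>, c) (u, \<zero>) = (\<zero>\<^bsub>G0\<^esub>, \<ominus> action u c)"
  "c \<in> part 1 \<Longrightarrow> d \<in> part 1 \<Longrightarrow> bracket (\<zero>\<^bsub>G0\<^esub>, c) (\<zero>\<^bsub>G0\<^esub>, d) = (c \<diamondop> d, \<zero>)"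
  by (simp_all add: bracket_def a_minus_def)

lemma bracket_bilinear: "bilinear_map G G G bracket"
  by (intro bilinear_mapI linear_mapI)
    (auto simp: bracket_def a_minus_def action_left action_right der_left der_right odot_linear
      minus_add smult_neg smult_add_right G0.smult_add_right a_ac G0.a_ac)

lemma D_eq: "a \<in> part 1 \<Longrightarrow> b \<in> part 1 \<Longrightarrow> c \<in> part 1 \<Longrightarrow> a \<star> (b \<star> c) \<oplus> b \<star> (a \<star> c) = D a b c"
  using even_commute[of "b \<star> c" a 1] even_commute[of "a \<star> c" b 1] by (simp add: D_def)

lemma bracket_is_ga_bracket: "is_ga_bracket V part (\<star>) bracket"
proof -
  have "der (a \<diamondop> b) (c \<diamondop> d) =
      2 \<odot>\<^bsub>G0\<^esub> ((a \<star> (b \<star> c)) \<diamondop> d) \<oplus>\<^bsub>G0\<^esub> 2 \<odot>\<^bsub>G0\<^esub> ((b \<star> (a \<star> d)) \<diamondop> c)"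
    if "a \<in> part 1" "b \<in> part 1" "c \<in> part 1" "d \<in> part 1" for a b c d
    using der_odot_odot[OF that] even_commute[of "b \<star> c" a 1] even_commute[of "a \<star> d" b 1] that
    by simp
  then show ?thesis
    unfolding is_ga_bracket_def Let_def
    by (simp add: bracket_bilinear D_eq action_odot)
qed

text \<open>The prescribed values cover all pairs of generators from \<open>ga_induct\<close>, and
  bilinearity propagates equality from there.\<close>

lemma ga_bracket_unique:
  assumes br: "is_ga_bracket V part (\<star>) br" and br': "is_ga_bracket V part (\<star>) br'"
    and "x \<in> carrier G" "y \<in> carrier G"
  shows "br x y = br' x y"
proof -
  have bil: "bilinear_map G G G br" "bilinear_map G G G br'"
    using br br' unfolding is_ga_bracket_def Let_def by blast+
  note l = bil[THEN bilinear_map_left] and r = bil[THEN bilinear_map_right]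
  note gen = br[unfolded is_ga_bracket_def Let_def] br'[unfolded is_ga_bracket_def Let_def]
  \<comment> \<open>With the first argument fixed, equality spreads in the second one; below, this
    is applied with a generator as first argument before the induction on \<open>x\<close>.\<close>
  have *: "br x y = br' x y"
    if y: "y \<in> carrier G" and x: "x \<in> carrier G"
      and even: "\<And>a b. a \<in> part 1 \<Longrightarrow> b \<in> part 1 \<Longrightarrow> br x (a \<diamondop> b, \<zero>) = br' x (a \<diamondop> b, \<zero>)"
      and odd: "\<And>a. a \<in> part 1 \<Longrightarrow> br x (\<zero>\<^bsub>G0\<^esub>, a) = br' x (\<zero>\<^bsub>G0\<^esub>, a)" for x y
    using y
  proof (induction rule: ga_induct)
    case (add y z)
    then show ?case using x by (simp only: r[THEN linear_map_add])
  next
    case (smult k y)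
    then show ?case using x by (simp only: r[THEN linear_map_smult])
  qed (use even odd in auto)
  show ?thesis
    using assms(3)
  proof (induction rule: ga_induct)
    case (even a b)
    then show ?case by (intro *[OF assms(4)]) (simp_all add: gen)
  next
    case (odd a)
    then show ?case by (intro *[OF assms(4)]) (simp_all add: gen)
  next
    case (add x z)
    then show ?case using assms(4) by (simp only: l[THEN linear_map_add])
  next
    case (smult k x)
    then show ?case using assms(4) by (simp only: l[THEN linear_map_smult])
  qed
qed

section \<open>The axioms of a Lie superalgebra\<close>

abbreviation "gpart \<equiv> ga_part V part (\<star>)"

lemma ga_part_cases:
  assumes "x \<in> gpart i"
  obtains u where "i = 0" "x = (u, \<zero>)" "u \<in> carrier G0"
    | c where "i = 1" "x = (\<zero>\<^bsub>G0\<^esub>, c)" "c \<in> part 1"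
  using assms by (cases i) (auto simp: ga_part_def)

lemma ga_part_simps:
  "u \<in> carrier G0 \<Longrightarrow> (u, \<zero>) \<in> gpart 0" "c \<in> part 1 \<Longrightarrow> (\<zero>\<^bsub>G0\<^esub>, c) \<in> gpart 1"
  by (simp_all add: ga_part_def)

lemma ga_superalgebra: "superalgebra G gpart bracket"
proof (intro superalgebra.intro graded_space.intro graded_space_axioms.intro
    superalgebra_axioms.intro)
  show "module scalars G" by (rule G.module_axioms)
  show "submodule (gpart i) scalars G" for i
    by (rule G.submodule_scalarsI) (auto simp: ga_part_def split: if_splits)
  show "gpart 0 <+>\<^bsub>G\<^esub> gpart 1 = carrier G"
  proof
    show "gpart 0 <+>\<^bsub>G\<^esub> gpart 1 \<subseteq> carrier G"
      by (auto simp: set_add_def' ga_part_def)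
    show "carrier G \<subseteq> gpart 0 <+>\<^bsub>G\<^esub> gpart 1"
    proof
      fix x assume "x \<in> carrier G"
      then obtain u c where "x = (u, c)" "u \<in> carrier G0" "c \<in> part 1" by auto
      then have "x = (u, \<zero>) \<oplus>\<^bsub>G\<^esub> (\<zero>\<^bsub>G0\<^esub>, c)" "(u, \<zero>) \<in> gpart 0" "(\<zero>\<^bsub>G0\<^esub>, c) \<in> gpart 1"
        by (simp_all add: ga_part_simps)
      then show "x \<in> gpart 0 <+>\<^bsub>G\<^esub> gpart 1" unfolding set_add_def' by blast
    qed
  qed
  show "gpart 0 \<inter> gpart 1 = {\<zero>\<^bsub>G\<^esub>}"
    by (auto simp: ga_part_def)
  show "bilinear_map G G G bracket" by (rule bracket_bilinear)
  show "bracket x y \<in> gpart (i + j)" if "x \<in> gpart i" "y \<in> gpart j" for x y i j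
    using that by (elim ga_part_cases) (simp_all add: ga_part_simps)
qed

text \<open>Antisymmetry turns the second and third terms into the negative of
  \<open>der u (der v w)\<close> and into \<open>der v (der u w)\<close>; \<open>der_der\<close>
  then makes the sum vanish.\<close>

lemma Jacobi_even:
  assumes [simp]: "u \<in> carrier G0" "v \<in> carrier G0" "w \<in> carrier G0"
  shows "der (der u v) w \<oplus>\<^bsub>G0\<^esub> der (der v w) u \<oplus>\<^bsub>G0\<^esub> der (der w u) v = \<zero>\<^bsub>G0\<^esub>"
proof -
  have 1: "der (der v w) u = \<ominus>\<^bsub>G0\<^esub> der u (der v w)" by (rule der_antisymmetric) simp_all
  have 2: "der (der w u) v = der v (der u w)"
    using der_antisymmetric[of "der w u" v] der_antisymmetric[of w u] by (simp add: neg_simps)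
  have *: "p \<oplus>\<^bsub>G0\<^esub> \<ominus>\<^bsub>G0\<^esub> (q \<oplus>\<^bsub>G0\<^esub> p) \<oplus>\<^bsub>G0\<^esub> q = \<zero>\<^bsub>G0\<^esub>" if "p \<in> carrier G0" "q \<in> carrier G0" for p q
    using that by algebra
  show ?thesis
    unfolding 1 2 der_der[OF assms] by (rule *) simp_all
qed

text \<open>Expanding \<open>D\<close> gives six terms, which cancel in pairs because the inner odd
  factors anticommute.\<close>

lemma Jacobi_odd:
  assumes "a \<in> part 1" "b \<in> part 1" "c \<in> part 1"
  shows "action (a \<diamondop> b) c \<oplus> action (b \<diamondop> c) a \<oplus> action (c \<diamondop> a) b = \<zero>"
proof -
  note [simp] = assms
  have n: "c \<star> a \<star> b = \<ominus> (a \<star> c \<star> b)" "b \<star> a \<star> c = \<ominus> (a \<star> b \<star> c)" "c \<star> b \<star> a = \<ominus> (b \<star> c \<star> a)"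
    using odd_anticommute[of c a] odd_anticommute[of b a] odd_anticommute[of c b]
    by (simp_all add: mul_left)
  have *: "p \<oplus> q \<oplus> (\<ominus> q \<oplus> \<ominus> r) \<oplus> (r \<oplus> \<ominus> p) = \<zero>"
    if "p \<in> carrier V" "q \<in> carrier V" "r \<in> carrier V" for p q r
    using that by algebra
  have "action (a \<diamondop> b) c \<oplus> action (b \<diamondop> c) a \<oplus> action (c \<diamondop> a) b =
      b \<star> c \<star> a \<oplus> a \<star> c \<star> b \<oplus> (\<ominus> (a \<star> c \<star> b) \<oplus> \<ominus> (a \<star> b \<star> c)) \<oplus> (a \<star> b \<star> c \<oplus> \<ominus> (b \<star> c \<star> a))"
    by (simp add: action_odot D_def n)
  also have "\<dots> = \<zero>" by (rule *) simp_all
  finally show ?thesis .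
qed

lemma Jacobi_even_even_odd:
  assumes "u \<in> carrier G0" "v \<in> carrier G0" "c \<in> part 1"
  shows "action (der u v) c \<oplus> \<ominus> action u (action v c) \<oplus> action v (action u c) = \<zero>"
proof -
  have *: "p \<oplus> \<ominus> (q \<oplus> p) \<oplus> q = \<zero>" if "p \<in> carrier V" "q \<in> carrier V" for p q
    using that by algebra
  show ?thesis unfolding action_der[OF assms] by (rule *) (use assms in simp_all)
qed

text \<open>By antisymmetry the middle term is the negative of
  \<open>der u (a \<diamondop> b)\<close>, which the Leibniz rule computes.\<close>

lemma Jacobi_even_odd_odd:
  assumes "u \<in> carrier G0" "a \<in> part 1" "b \<in> part 1"
  shows "action u a \<diamondop> b \<oplus>\<^bsub>G0\<^esub> der (a \<diamondop> b) u \<oplus>\<^bsub>G0\<^esub> action u b \<diamondop> a = \<zero>\<^bsub>G0\<^esub>"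
proof -
  have 1: "der (a \<diamondop> b) u = \<ominus>\<^bsub>G0\<^esub> (action u a \<diamondop> b \<oplus>\<^bsub>G0\<^esub> action u b \<diamondop> a)"
    using assms der_antisymmetric[of "a \<diamondop> b" u] odot_commute[of a "action u b"]
    by (simp add: der_odot)
  have *: "p \<oplus>\<^bsub>G0\<^esub> \<ominus>\<^bsub>G0\<^esub> (p \<oplus>\<^bsub>G0\<^esub> q) \<oplus>\<^bsub>G0\<^esub> q = \<zero>\<^bsub>G0\<^esub>" if "p \<in> carrier G0" "q \<in> carrier G0" for p q
    using that by algebra
  show ?thesis unfolding 1 by (rule *) (use assms in simp_all)
qed

text \<open>Parity patterns with the same number of odd arguments are cyclic shifts of each other,
  and the Jacobi sum is cyclic, so the four Jacobi lemmas cover all eight patterns.\<close>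

lemma ga_lie_superalgebra: "lie_superalgebra G gpart bracket"
proof (intro lie_superalgebra.intro lie_superalgebra_axioms.intro ga_superalgebra)
  show "bracket x y = (- parity_sign (i * j)) \<odot>\<^bsub>G\<^esub> bracket y x"
    if "x \<in> gpart i" "y \<in> gpart j" for x y i j
    using that
    by (elim ga_part_cases)
      (simp_all add: parity_sign_def smult_neg_one G0.smult_neg_one der_antisymmetric[symmetric]
        odot_commute)
  show "parity_sign (i * l) \<odot>\<^bsub>G\<^esub> bracket (bracket x y) z \<oplus>\<^bsub>G\<^esub>
        parity_sign (j * i) \<odot>\<^bsub>G\<^esub> bracket (bracket y z) x \<oplus>\<^bsub>G\<^esub>
        parity_sign (l * j) \<odot>\<^bsub>G\<^esub> bracket (bracket z x) y = \<zero>\<^bsub>G\<^esub>"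
    if "x \<in> gpart i" "y \<in> gpart j" "z \<in> gpart l" for x y z i j l
    using that(1)
  proof (cases rule: ga_part_cases)
    case x: (1 u)
    from that(2) show ?thesis
    proof (cases rule: ga_part_cases)
      case y: (1 v)
      from that(3) show ?thesis
      proof (cases rule: ga_part_cases)
        case z: (1 w)
        show ?thesis using x y z Jacobi_even[of u v w] by (simp add: parity_sign_def)
      next
        case z: (2 c)
        show ?thesis
          using x y z Jacobi_even_even_odd[of u v c] by (simp add: parity_sign_def neg_simps)
      qed
    next
      case y: (2 b)
      from that(3) show ?thesis
      proof (cases rule: ga_part_cases)
        case z: (1 w)
        show ?thesis
          using x y z Jacobi_even_even_odd[of w u b] by (simp add: parity_sign_def neg_simps a_ac)
      next
        case z: (2 c)
        show ?thesis
          using x y z Jacobi_even_odd_odd[of u b c]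
          by (simp add: parity_sign_def G0.smult_neg_one odot_linear)
      qed
    qed
  next
    case x: (2 a)
    from that(2) show ?thesis
    proof (cases rule: ga_part_cases)
      case y: (1 v)
      from that(3) show ?thesis
      proof (cases rule: ga_part_cases)
        case z: (1 w)
        show ?thesis
          using x y z Jacobi_even_even_odd[of v w a] by (simp add: parity_sign_def neg_simps a_ac)
      next
        case z: (2 c)
        show ?thesis
          using x y z Jacobi_even_odd_odd[of v c a]
          by (simp add: parity_sign_def G0.smult_neg_one odot_linear G0.a_ac)
      qed
    next
      case y: (2 b)
      from that(3) show ?thesis
      proof (cases rule: ga_part_cases)
        case z: (1 w)
        show ?thesis
          using x y z Jacobi_even_odd_odd[of w a b]
          by (simp add: parity_sign_def G0.smult_neg_one odot_linear G0.a_ac)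
      next
        case z: (2 c)
        \<comment> \<open>For three odd arguments all parity signs are -1, so the sum of
          \<open>Jacobi_odd\<close> appears negated.\<close>
        have "\<ominus> action (a \<diamondop> b) c \<oplus> \<ominus> action (b \<diamondop> c) a \<oplus> \<ominus> action (c \<diamondop> a) b = \<ominus> \<zero>"
          using x y z by (simp add: minus_add[symmetric] Jacobi_odd)
        then show ?thesis using x y z by (simp add: parity_sign_def smult_neg_one)
      qed
    qed
  qed
qed

end

text \<open>Existence of \<open>br\<close> expresses that the formulas respect the relations.
  Uniqueness is stated on the carrier, since bilinearity does not constrain values outside
  it.\<close>

theorem theorem1:
  fixes A :: "('k::real_normed_field, 'v) module"
    and part :: "bit \<Rightarrow> 'v set"
    and mul :: "'v \<Rightarrow> 'v \<Rightarrow> 'v"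
  assumes "lie_antialgebra A part mul"
  shows "\<exists>br. is_ga_bracket A part mul br \<and>
    (\<forall>br'. is_ga_bracket A part mul br' \<longrightarrow>
      (\<forall>x \<in> carrier (ga A part mul). \<forall>y \<in> carrier (ga A part mul). br' x y = br x y)) \<and>
    lie_superalgebra (ga A part mul) (ga_part A part mul) br"
proof -
  interpret lie_antialgebra A part mul by fact
  \<comment> \<open>A real normed field has characteristic zero, so 2 is nonzero.\<close>
  interpret lie_antialgebra_char_neq_2 A part mul by unfold_locales simp
  show ?thesis
    using bracket_is_ga_bracket ga_bracket_unique ga_lie_superalgebra by blast
qed

end
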